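(* Up to isomorphism there are exactly three proper Mathon arcs of degree $8$ in $\mathrm{PG}(2,32)$.
   Context: Let $q$ be a power of $2$ and $\mathrm{Tr}:\mathrm{GF}(q)\to\mathrm{GF}(2)$ the absolute trace. A maximal arc of degree $d$ in $\mathrm{PG}(2,q)$ is a non-empty proper set of points meeting every line in $0$ or $d$ points. For $\alpha,\beta,\lambda\in\mathrm{GF}(q)$ with $\mathrm{Tr}(\alpha\beta)=1$ let $F_{\alpha,\beta,\lambda}=\{(x,y,z):\alpha x^2+xy+\beta y^2+\lambda z^2=0\}$. For $\lambda\ne0$ this is a non-degenerate conic with nucleus $F_0=(0,0,1)$, and the line $z=0$ is external to it. For $\lambda\ne\lambda'$ define $F_{\alpha,\beta,\lambda}\oplus F_{\alpha',\beta',\lambda'}=F_{\alpha'',\beta'',\lambda''}$ with $\alpha''=\frac{\alpha\lambda+\alpha'\lambda'}{\lambda+\lambda'}$, $\beta''=\frac{\beta\lambda+\beta'\lambda'}{\lambda+\lambda'}$, $\lambda''=\lambda+\lambda'$. A set $\mathcal C$ of such conics ($\lambda\neq0$, distinct members having distinct $\lambda$) is closed if the composition of any two distinct members is again a member of $\mathcal C$ (in particular the parameters of the composition satisfy the trace condition). For closed $\mathcal C$ the union of the conics of $\mathcal C$ together with $F_0$ is a maximal arc of degree $|\mathcal C|+1$; a maximal arc which, after a change of coordinates of the plane, arises in this way from a non-empty closed set is called of Mathon type (a Mathon arc). If $\mathrm{Tr}(\alpha)=1$ and $A\subset\mathrm{GF}(q)$ is an additive subgroup, the set $\{F_{\alpha,1,\lambda}:\lambda\in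 A\setminus\{0\}\}$ is closed; a maximal arc arising (up to change of coordinates) from such a set is of Denniston type. A proper Mathon arc is a maximal arc of Mathon type that is not of Denniston type. Two maximal arcs are isomorphic if some element of $\mathrm{P\Gamma L}(3,q)$ maps one onto the other. *)

theory Defs
  imports "HOL-Analysis.Cartesian_Space"
begin

text \<open>
  The plane \<open>PG(2,q)\<close>, with \<open>q = CARD('a)\<close>, is modelled by the subspaces of \<open>'a ^ 3\<close>: points and
  lines are the subspaces of dimension 1 and 2, and incidence is inclusion.
\<close>

definition pg_points :: "('a::{field,finite} ^ 3) set set" where
  "pg_points = {P. vec.subspace P \<and> vec.dim P = 1}"

definition pg_lines :: "('a::{field,finite} ^ 3) set set" where
  "pg_lines = {L. vec.subspace L \<and> vec.dim L = 2}"

definition maximal_arc :: "nat \<Rightarrow> ('a::{field,finite} ^ 3) set set \<Rightarrow> bool" where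
  "maximal_arc d K \<longleftrightarrow>
     K \<noteq> {} \<and> K \<subset> pg_points \<and>
     (\<forall>L\<in>pg_lines. card {P \<in> K. P \<subseteq> L} = 0 \<or> card {P \<in> K. P \<subseteq> L} = d)"

definition field_automorphism :: "('a::field \<Rightarrow> 'a) \<Rightarrow> bool" where
  "field_automorphism \<sigma> \<longleftrightarrow>
     bij \<sigma> \<and> (\<forall>x y. \<sigma> (x + y) = \<sigma> x + \<sigma> y) \<and> (\<forall>x y. \<sigma> (x * y) = \<sigma> x * \<sigma> y)"

text \<open>
  Both groups are given as maps on subspaces; proportional matrices induce the same map on points.
\<close>

definition PGL3 :: "(('a::{field,finite} ^ 3) set \<Rightarrow> ('a ^ 3) set) set" where
  "PGL3 = {(\<lambda>P. (\<lambda>v. M *v v) ` P) | M :: 'a ^ 3 ^ 3. invertible M}"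

definition PGammaL3 :: "(('a::{field,finite} ^ 3) set \<Rightarrow> ('a ^ 3) set) set" where
  "PGammaL3 = {(\<lambda>P. (\<lambda>v. M *v (\<chi> i. \<sigma> (v $ i))) ` P) | (M :: 'a ^ 3 ^ 3) \<sigma>.
     invertible M \<and> field_automorphism \<sigma>}"

definition arc_iso :: "(('a::{field,finite} ^ 3) set set \<times> ('a ^ 3) set set) set" where
  "arc_iso = {(K, K'). \<exists>\<phi>\<in>PGammaL3. \<phi> ` K = K'}"

text \<open>
  For \<open>q = 2^h\<close> the indices \<open>i\<close> with \<open>2^i < q\<close> are \<open>0, \<dots>, h - 1\<close>, so this is the absolute trace,
  with \<open>GF(2)\<close> identified with the prime subfield \<open>{0, 1}\<close>.
\<close>

definition abs_trace :: "'a::{field,finite} \<Rightarrow> 'a" where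
  "abs_trace x = (\<Sum>i | 2 ^ i < CARD('a). x ^ (2 ^ i))"

text \<open>
  A triple \<open>(\<alpha>, \<beta>, \<lambda>)\<close> stands for the conic \<open>\<alpha> x\<^sup>2 + x y + \<beta> y\<^sup>2 + \<lambda> z\<^sup>2 = 0\<close>,
  whose equation is normalised by the coefficient of \<open>x y\<close>.
\<close>

fun conic_points :: "'a::{field,finite} \<times> 'a \<times> 'a \<Rightarrow> ('a ^ 3) set set" where
  "conic_points (\<alpha>, \<beta>, l) =
     {vec.span {v} | v. v \<noteq> 0 \<and>
        \<alpha> * (v $ 1)\<^sup>2 + v $ 1 * v $ 2 + \<beta> * (v $ 2)\<^sup>2 + l * (v $ 3)\<^sup>2 = 0}"

definition nucleus :: "('a::{field,finite} ^ 3) set" where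
  "nucleus = vec.span {vector [0, 0, 1]}"

fun conic_comp :: "'a::field \<times> 'a \<times> 'a \<Rightarrow> 'a \<times> 'a \<times> 'a \<Rightarrow> 'a \<times> 'a \<times> 'a" where
  "conic_comp (\<alpha>, \<beta>, l) (\<alpha>', \<beta>', l') =
     ((\<alpha> * l + \<alpha>' * l') / (l + l'), (\<beta> * l + \<beta>' * l') / (l + l'), l + l')"

definition closed_conics :: "('a::{field,finite} \<times> 'a \<times> 'a) set \<Rightarrow> bool" where
  "closed_conics C \<longleftrightarrow>
     (\<forall>(\<alpha>, \<beta>, l)\<in>C. abs_trace (\<alpha> * \<beta>) = 1 \<and> l \<noteq> 0) \<and>
     inj_on (\<lambda>(\<alpha>, \<beta>, l). l) C \<and>
     (\<forall>c\<in>C. \<forall>c'\<in>C. c \<noteq> c' \<longrightarrow> conic_comp c c' \<in> C)"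

text \<open>\<open>K\<close> is a maximal arc that arises from \<open>C\<close> after a change of coordinates.\<close>

definition arc_from :: "('a::{field,finite} \<times> 'a \<times> 'a) set \<Rightarrow> ('a ^ 3) set set \<Rightarrow> bool" where
  "arc_from C K \<longleftrightarrow>
     (\<exists>d. maximal_arc d K) \<and>
     (\<exists>\<phi>\<in>PGL3. K = \<phi> ` (insert nucleus (\<Union>c\<in>C. conic_points c)))"

definition mathon_type :: "('a::{field,finite} ^ 3) set set \<Rightarrow> bool" where
  "mathon_type K \<longleftrightarrow> (\<exists>C. C \<noteq> {} \<and> closed_conics C \<and> arc_from C K)"

definition denniston_type :: "('a::{field,finite} ^ 3) set set \<Rightarrow> bool" where
  "denniston_type K \<longleftrightarrow>
     (\<exists>\<alpha> A. abs_trace \<alpha> = 1 \<and> 0 \<in> A \<and> (\<forall>x\<in>A. \<forall>y\<in>A. x - y \<in> A) \<and>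
        arc_from {(\<alpha>, 1, l) | l. l \<in> A - {0}} K)"

definition proper_mathon_arc :: "('a::{field,finite} ^ 3) set set \<Rightarrow> bool" where
  "proper_mathon_arc K \<longleftrightarrow> mathon_type K \<and> \<not> denniston_type K"

end

(*
  On the subgroup A = {0} \<union> {\<lambda>} of order 8 attached to a closed set of 7 conics, \<lambda>\<alpha> and \<lambda>\<beta> are
  additive, so \<alpha> = c0 + c1 \<lambda> + c2 \<lambda>^3 and \<beta> = d0 + d1 \<lambda> + d2 \<lambda>^3. Substitutions z -> z + ex + fy kill
  c1 and d1; the arc is of Denniston type iff then c2 = d2 = 0. Otherwise a linear change of x, y
  makes \<alpha> = 1 and \<beta> = t + \<lambda>^3 with t in GF(2), and disjointness of the conics says
  Tr(\<lambda>\<mu>(\<lambda> + \<mu>)) = 1 + t for all distinct nonzero \<lambda>, \<mu> in A. The left-hand side is an alternating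
  bilinear form on GF(32) over GF(2), so t = 1 and A is totally isotropic. The radical of the form
  is GF(2), hence the admissible A correspond to the 15 lines of the generalized quadrangle W(3,2).

  Conversely, a conic contained in such an arc is one of its 7 conics, since by Bezout any other
  conic has at most 1 + 7 * 4 < 33 points in common with the arc. Comparing coefficients, the arcs
  of A and B are isomorphic iff a field automorphism maps A to B. The automorphism group has order
  5 and acts without fixed points on the 15 subgroups, which leaves 3 classes.
*)

theory Submission
  imports Defs "HOL-Analysis.Determinants" "HOL-Computational_Algebra.Polynomial"
begin

section \<open>The field with 32 elements\<close>

text \<open>The normal form \<alpha> = 1, \<beta> = 1 + \<lambda>^3 makes equations comparable but
  gives up the external line z = 0. Every admissible A contains 1, and the conic with \<lambda> = 1
  is x^2 + x y + z^2 = 0, which violates the trace condition, so the seven conics do not form a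
  closed set. The argument therefore works with pairwise disjointness of the conics, a property that
  survives coordinate changes. That the normal forms are of Mathon type is recovered separately, by
  a double count that produces another external line.

  The number 31 enters in two ways. It is coprime to 3, so cubing is bijective: a leading
  coefficient can be scaled to 1, and no scalar freedom is left between two normal forms. It is
  prime, so every element other than 0 and 1 generates the multiplicative group, and a field
  automorphism is known from one value. The degree 5 of the field is odd, which gives Tr 1 = 1, and
  prime, which makes every nontrivial power of Frobenius generate the whole automorphism
  group.\<close>

locale gf32 =
  fixes F :: "'a::{field,finite} itself"
  assumes card_field: "CARD('a) = 32"
begin

text \<open>Multiplication by a nonzero x permutes the 31 nonzero elements, so their product absorbs
  the factor x^31.\<close>

lemma power_32: "(x::'a) ^ 32 = x"
proof (cases "x = 0")
  case False
  have "(\<Prod>y\<in>UNIV - {0}. x * y) = (\<Prod>y\<in>UNIV - {0}. y)"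
    by (rule prod.reindex_bij_witness[of _ "\<lambda>y. y / x" "\<lambda>y. x * y"]) (use False in auto)
  moreover have "card (UNIV - {0::'a}) = 31" by (simp add: card_field)
  ultimately have "x ^ 31 * \<Prod>(UNIV - {0::'a}) = \<Prod>(UNIV - {0})"
    by (simp add: prod.distrib)
  then have "x ^ 31 = 1" by simp
  then have "x * x ^ 31 = x" by simp
  then show ?thesis by (simp flip: power_Suc)
qed simp

text \<open>The exponent 32 is even, so the 32nd power of -1 is both 1 and -1.\<close>

lemma two_eq_0: "(2::'a) = 0"
proof -
  have "(- 1 :: 'a) ^ 32 = 1" by simp
  then have "(- 1 :: 'a) = 1" using power_32 by metis
  then show ?thesis by (metis add.right_inverse one_add_one)
qed

lemma add_self: "(x::'a) + x = 0"
  using two_eq_0 by (metis mult_2 mult_zero_left)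

lemma add_self_left: "(x::'a) + (x + y) = y"
  by (simp add: add.assoc[symmetric] add_self)

lemma minus_eq: "- (x::'a) = x"
  using add_self[of x] by (simp add: add_eq_0_iff)

lemma diff_eq: "(x::'a) - y = x + y"
  by (metis diff_minus_eq_add minus_eq)

lemmas char_2 = add_self add_self_left minus_eq diff_eq two_eq_0

lemma add_eq_0_char2: "(x::'a) + y = 0 \<longleftrightarrow> x = y"
  by (metis add_self add_left_cancel)

lemma square_add: "((x::'a) + y)\<^sup>2 = x\<^sup>2 + y\<^sup>2"
  by (simp add: power2_sum two_eq_0)

lemma frob_add: "((x::'a) + y) ^ (2 ^ i) = x ^ (2 ^ i) + y ^ (2 ^ i)"
proof (induction i)
  case (Suc i)
  have "(x + y) ^ (2 ^ Suc i) = ((x + y) ^ (2 ^ i))\<^sup>2"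
    by (simp add: power_mult mult.commute flip: power_mult)
  also have "\<dots> = (x ^ (2 ^ i))\<^sup>2 + (y ^ (2 ^ i))\<^sup>2"
    by (simp add: Suc square_add)
  finally show ?case by (simp add: power_mult mult.commute flip: power_mult)
qed simp

lemma square_inj: "(x::'a)\<^sup>2 = y\<^sup>2 \<longleftrightarrow> x = y"
  by (metis add_eq_0_char2 power_eq_0_iff square_add zero_neq_numeral)

lemma square_surj: "\<exists>s::'a. s\<^sup>2 = x"
proof
  have "(x ^ 16)\<^sup>2 = x ^ 32" by (simp flip: power_mult)
  then show "(x ^ 16)\<^sup>2 = x" by (simp only: power_32)
qed

lemma power_31: "(x::'a) \<noteq> 0 \<Longrightarrow> x ^ 31 = 1"
  using power_32[of x] power_Suc[of x 31] by simp

lemma cube_surj: "\<exists>s::'a. s ^ 3 = x"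
proof (cases "x = 0")
  case False
  \<comment> \<open>21 * 3 = 63 = 31 + 32, so x^21 is a cube root of x.\<close>
  have "(x ^ 21) ^ 3 = x ^ 31 * x ^ 32" by (simp flip: power_mult power_add)
  then have "(x ^ 21) ^ 3 = x" by (simp only: power_32 power_31[OF False] mult_1)
  then show ?thesis ..
qed auto

text \<open>The nonzero elements form a group of order 31. The cases that matter are n = 3
  (uniqueness of a scaling factor), n = 14 (the radical of the pairing) and differences of exponents
  below 31.\<close>

lemma power_coprime_31_eq_1:
  assumes "(x::'a) \<noteq> 0" "x ^ n = 1" "coprime n 31"
  shows "x = 1"
proof -
  obtain a b where ab: "n * a = 31 * b + 1"
  proof -
    from assms(3) have "n \<noteq> 0" by (cases "n = 0") auto
    then obtain a b where "n * a = 31 * b + gcd n 31" using bezout_nat by blast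
    then show thesis using that assms(3) by simp
  qed
  have "x ^ (n * a) = x ^ (31 * b) * x" by (simp add: ab)
  then show ?thesis using assms(2) power_31[OF assms(1)] by (simp add: power_mult)
qed

lemma coprime_31:
  assumes "0 < n" "n < 31"
  shows "coprime n (31 :: nat)"
proof -
  have "prime (31 :: nat)" by (simp add: prime_nat_numeral_eq)
  then show ?thesis using assms by (metis coprime_commute nat_dvd_not_less prime_imp_coprime_nat)
qed

section \<open>The absolute trace and Artin-Schreier equations\<close>

definition Tr :: "'a \<Rightarrow> 'a" where
  "Tr x = x + x ^ 2 + x ^ 4 + x ^ 8 + x ^ 16"

lemma abs_trace_eq: "abs_trace (x::'a) = Tr x"
proof -
  have "(2::nat) ^ i < 32 \<longleftrightarrow> i < 5" for i
    using power_strict_increasing_iff[of "2::nat" i 5] by simp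
  then have "{i::nat. 2 ^ i < CARD('a)} = {i. i < 5}" by (simp only: card_field)
  also have "\<dots> = {0, 1, 2, 3, 4}" by auto
  finally show ?thesis by (simp add: abs_trace_def Tr_def add_ac power2_eq_square)
qed

lemma Tr_add: "Tr (x + y) = Tr x + Tr y"
  using frob_add[of x y 2] frob_add[of x y 3] frob_add[of x y 4]
  by (simp add: Tr_def square_add add_ac)

lemma Tr_square: "Tr (x\<^sup>2) = Tr x"
  using power_32[of x] by (simp add: Tr_def algebra_simps flip: power_mult)

lemma Tr_square': "(Tr x)\<^sup>2 = Tr x"
  using Tr_square[of x] by (simp add: Tr_def square_add flip: power_mult)

lemma Tr_cases: "Tr x = 0 \<or> Tr x = 1"
  using Tr_square'[of x] by (simp add: power2_eq_square)

lemma Tr_0 [simp]: "Tr 0 = 0" and Tr_1 [simp]: "Tr 1 = 1"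
  by (simp_all add: Tr_def char_2)

lemma Tr_frob: "Tr (x ^ (2 ^ i)) = Tr x"
proof (induction i)
  case (Suc i)
  have "x ^ (2 ^ Suc i) = (x ^ (2 ^ i))\<^sup>2" by (simp add: mult.commute flip: power_mult)
  then show ?case by (simp add: Tr_square Suc)
qed simp

lemma card_roots_le:
  fixes c :: "nat \<Rightarrow> 'a"
  assumes "i \<le> n" "c i \<noteq> 0"
  shows "card {x. (\<Sum>j\<le>n. c j * x ^ j) = 0} \<le> n"
proof -
  define p where "p = (\<Sum>j\<le>n. monom (c j) j)"
  have "coeff p i \<noteq> 0" using assms by (simp add: p_def coeff_sum)
  then have "p \<noteq> 0" by auto
  moreover have "degree p \<le> n" unfolding p_def
    by (rule degree_sum_le) (auto intro: order.trans[OF degree_monom_le])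
  moreover have "{x. (\<Sum>j\<le>n. c j * x ^ j) = 0} = {x. poly p x = 0}"
    by (simp add: p_def poly_sum poly_monom)
  ultimately show ?thesis using card_poly_roots_bound[of p] by simp
qed

text \<open>The tool for comparing coefficients. The variable is either the parameter of a point on
  a conic or the \<lambda> of one of seven conics; both supply more than four zeros.\<close>

lemma quartic_eq_0:
  fixes a0 :: 'a
  assumes "4 < card {x. a0 + a1 * x + a2 * x ^ 2 + a3 * x ^ 3 + a4 * x ^ 4 = 0}"
  shows "a0 = 0 \<and> a1 = 0 \<and> a2 = 0 \<and> a3 = 0 \<and> a4 = 0"
proof (rule ccontr)
  define c where "c = (\<lambda>j::nat. if j = 0 then a0 else if j = 1 then a1 else if j = 2 then a2 else if j = 3 then a3 else a4)"
  assume "\<not> ?thesis"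
  then have "c 0 \<noteq> 0 \<or> c 1 \<noteq> 0 \<or> c 2 \<noteq> 0 \<or> c 3 \<noteq> 0 \<or> c 4 \<noteq> 0" by (simp add: c_def)
  then obtain i where "i \<le> 4" "c i \<noteq> 0" using that[of 0] that[of 1] that[of 2] that[of 3] that[of 4] by auto
  then have "card {x. (\<Sum>j\<le>4. c j * x ^ j) = 0} \<le> 4" by (rule card_roots_le)
  then show False using assms by (simp add: c_def atMost_nat_numeral add_ac)
qed

lemma quartic_eq_0_on:
  fixes a0 :: 'a
  assumes "\<And>x. x \<in> S \<Longrightarrow> a0 + a1 * x + a2 * x ^ 2 + a3 * x ^ 3 + a4 * x ^ 4 = 0" "4 < card S"
  shows "a0 = 0 \<and> a1 = 0 \<and> a2 = 0 \<and> a3 = 0 \<and> a4 = 0"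
proof (rule quartic_eq_0)
  have "card S \<le> card {x. a0 + a1 * x + a2 * x ^ 2 + a3 * x ^ 3 + a4 * x ^ 4 = 0}"
    using assms(1) by (intro card_mono) auto
  then show "4 < card {x. a0 + a1 * x + a2 * x ^ 2 + a3 * x ^ 3 + a4 * x ^ 4 = 0}" using assms(2) by simp
qed

text \<open>The trace is a polynomial of degree 16, written with a full list of coefficients to suit
  \<open>card_roots_le\<close>. The matching lower bound comes from the image of t^2 + t.\<close>

lemma card_Tr_eq_0_le: "card {x. Tr x = 0} \<le> 16"
proof -
  have "(\<Sum>j\<le>16. of_bool (j \<in> {1,2,4,8,16}) * x ^ j) = Tr x" for x
  proof -
    have "(\<Sum>j\<le>16. of_bool (j \<in> {1,2,4,8,16}) * x ^ j) = (\<Sum>j\<in>{1,2,4,8,16}. x ^ j)"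
      by (rule sum.mono_neutral_cong_right) auto
    then show ?thesis by (simp add: Tr_def add_ac)
  qed
  then show ?thesis
    using card_roots_le[of 1 16 "\<lambda>j. of_bool (j \<in> {1,2,4,8,16})"] by simp
qed

lemma artin_schreier_eq_iff: "s\<^sup>2 + s = t\<^sup>2 + t \<longleftrightarrow> s = t \<or> s = t + (1::'a)"
proof -
  have "s\<^sup>2 + s = t\<^sup>2 + t \<longleftrightarrow> (s + t) * (s + t + 1) = 0"
    by (subst add_eq_0_char2[symmetric])
       (simp add: power2_eq_square algebra_simps char_2)
  also have "\<dots> \<longleftrightarrow> s + t = 0 \<or> s + (t + 1) = 0" by (simp add: add.assoc)
  finally show ?thesis by (simp only: add_eq_0_char2)
qed

text \<open>Additive Hilbert 90 by counting: t^2 + t identifies exactly t and t + 1, so its image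
  has 16 elements; it lies in the kernel of the trace, which has at most 16.\<close>

lemma Tr_eq_0: "{x. Tr x = 0} = range (\<lambda>t. t\<^sup>2 + t)" (is "?K = range ?g")
  and card_Tr_eq_0: "card {x. Tr x = 0} = 16"
proof -
  have sub: "range ?g \<subseteq> ?K" by (auto simp: Tr_add Tr_square add_self)
  have "card {s \<in> UNIV. ?g s = y} = 2" if "y \<in> range ?g" for y
  proof -
    obtain t where t: "y = ?g t" using \<open>y \<in> range ?g\<close> by blast
    have "{s \<in> UNIV. ?g s = y} = {t, t + 1}" unfolding t artin_schreier_eq_iff by auto
    then show ?thesis by simp
  qed
  then have "CARD('a) = 2 * card (range ?g)"
    using sum.image_gen[of "UNIV::'a set" "\<lambda>_. 1::nat" ?g] by simp
  then have "card (range ?g) = 16" by (simp add: card_field)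
  then show "?K = range ?g" "card ?K = 16"
    using card_seteq[OF _ sub] card_Tr_eq_0_le by auto
qed

lemma Tr_eq_0_iff: "Tr x = 0 \<longleftrightarrow> (\<exists>t. x = t\<^sup>2 + t)"
  using Tr_eq_0 by blast

lemma card_Tr_eq_1: "card {x. Tr x = 1} = 16"
proof -
  have "{x. Tr x = 1} = UNIV - {x. Tr x = 0}" using Tr_cases by force
  then show ?thesis by (simp add: card_Diff_subset card_Tr_eq_0 card_field)
qed

text \<open>Nondegeneracy of the trace form: the test element 1 / k yields Tr 1 = 1.\<close>

lemma Tr_mult_eq_0_imp:
  assumes "\<And>v. Tr (v * k) = 0"
  shows "k = 0"
proof (rule ccontr)
  assume "k \<noteq> 0"
  then have "Tr (1 / k * k) = 1" by simp
  then show False using assms by (metis zero_neq_one)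
qed

lemma card_Tr_mult_eq_0:
  assumes "k \<noteq> 0"
  shows "card {v. Tr (v * k) = 0} = 16"
proof -
  have "bij_betw (\<lambda>v. v * k) {v. Tr (v * k) = 0} {x. Tr x = 0}"
    by (rule bij_betwI[where g = "\<lambda>x. x / k"]) (use assms in auto)
  then show ?thesis using card_Tr_eq_0 bij_betw_same_card by metis
qed

text \<open>The substitution t = A x / (s y) turns a zero with y nonzero into t^2 + t = A B. The
  coefficients are scaled by s and s^2 because s will be the sum of the \<lambda> of two
  conics.\<close>

lemma quadratic_anisotropic:
  assumes "Tr (A * B) = 1" and "s \<noteq> 0" and "A * x\<^sup>2 + s * x * y + s\<^sup>2 * B * y\<^sup>2 = 0"
  shows "x = 0 \<and> y = (0::'a)"
proof -
  have A: "A \<noteq> 0" using assms(1) by auto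
  have "y = 0"
  proof (rule ccontr)
    assume y: "y \<noteq> 0"
    define t where "t = A * x / (s * y)"
    have "(A * x\<^sup>2 + s * x * y + s\<^sup>2 * B * y\<^sup>2) * A / (s\<^sup>2 * y\<^sup>2) = t\<^sup>2 + t + A * B"
      using y assms(2) by (simp add: t_def field_simps power2_eq_square)
    then have "A * B = t\<^sup>2 + t" using assms(3) by (simp add: add_eq_0_char2)
    then show False using assms(1) Tr_eq_0_iff by (metis zero_neq_one)
  qed
  then show ?thesis using assms(3) A by simp
qed

lemma quadratic_isotropic:
  assumes "Tr (A * B) = 0" and "s \<noteq> 0"
  shows "\<exists>x y. (x, y) \<noteq> (0, 0) \<and> A * x\<^sup>2 + s * x * y + s\<^sup>2 * B * y\<^sup>2 = (0::'a)"
proof (cases "A = 0")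
  case True
  then show ?thesis by (intro exI[of _ 1] exI[of _ 0]) simp
next
  case False
  obtain t where t: "A * B = t\<^sup>2 + t" using assms(1) Tr_eq_0_iff by blast
  have "A * (A * (s * t / A)\<^sup>2 + s * (s * t / A) * 1 + s\<^sup>2 * B * 1\<^sup>2) = s\<^sup>2 * (t\<^sup>2 + t + A * B)"
    using False by (simp add: field_simps power2_eq_square)
  then have "A * (s * t / A)\<^sup>2 + s * (s * t / A) * 1 + s\<^sup>2 * B * 1\<^sup>2 = 0"
    using False by (simp add: t add_self)
  then show ?thesis by (metis prod.inject zero_neq_one)
qed

end

section \<open>Conics and collineations\<close>

definition conic_form :: "'a::field \<times> 'a \<times> 'a \<Rightarrow> 'a ^ 3 \<Rightarrow> 'a" where
  "conic_form = (\<lambda>(\<alpha>, \<beta>, l) v. \<alpha> * (v $ 1)\<^sup>2 + v $ 1 * v $ 2 + \<beta> * (v $ 2)\<^sup>2 + l * (v $ 3)\<^sup>2)"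

definition conic_arc :: "('a::{field,finite} \<times> 'a \<times> 'a) set \<Rightarrow> ('a ^ 3) set set" where
  "conic_arc C = insert nucleus (\<Union>c\<in>C. conic_points c)"

lemma conic_points_eq: "conic_points c = {vec.span {v} | v. v \<noteq> 0 \<and> conic_form c v = 0}"
  by (cases c) (simp add: conic_form_def)

lemma conic_form_scale: "conic_form c (k *s v) = k\<^sup>2 * conic_form c v"
  by (cases c) (simp add: conic_form_def power_mult_distrib algebra_simps power2_eq_square)

lemma vec3_eq_iff: "v = w \<longleftrightarrow> v $ 1 = w $ 1 \<and> v $ 2 = w $ 2 \<and> v $ 3 = (w $ 3 :: 'b)" for v :: "'b ^ 3"
  by (simp add: vec_eq_iff forall_3)

lemma span_singleton_scale:
  fixes v :: "'a::field ^ 'n"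
  assumes "k \<noteq> 0"
  shows "vec.span {k *s v} = vec.span {v}"
proof -
  have "range (\<lambda>j. j * k) = UNIV" using assms by (intro surjI[of _ "\<lambda>j. j / k"]) simp
  then have "(\<lambda>j. j *s v) ` range (\<lambda>j. j * k) = range (\<lambda>j. j *s v)" by simp
  then show ?thesis by (simp add: vec.span_singleton image_image)
qed

lemma span_singleton_eqD:
  fixes v w :: "'a::field ^ 'n"
  assumes "vec.span {v} = vec.span {w}" "v \<noteq> 0"
  shows "\<exists>k. k \<noteq> 0 \<and> v = k *s w"
proof -
  have "v \<in> vec.span {w}" using assms(1) vec.span_base[of v "{v}"] by simp
  then obtain k where "v = k *s w" unfolding vec.span_singleton by blast
  then show ?thesis using assms(2) by auto
qed

lemma span_mem_conic_points:
  assumes "v \<noteq> 0"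
  shows "vec.span {v} \<in> conic_points c \<longleftrightarrow> conic_form c v = 0"
proof
  assume "vec.span {v} \<in> conic_points c"
  then obtain w where w: "conic_form c w = 0" "vec.span {v} = vec.span {w}"
    unfolding conic_points_eq by blast
  then obtain k where "v = k *s w" using span_singleton_eqD assms by blast
  then show "conic_form c v = 0" by (simp add: conic_form_scale w)
qed (use assms in \<open>auto simp: conic_points_eq\<close>)

lemma span_eq_nucleus:
  assumes "v \<noteq> 0"
  shows "vec.span {v} = nucleus \<longleftrightarrow> v $ 1 = 0 \<and> v $ 2 = 0"
proof
  assume "vec.span {v} = nucleus"
  then obtain k where "v = k *s vector [0, 0, 1]"
    unfolding nucleus_def using span_singleton_eqD assms by blast
  then show "v $ 1 = 0 \<and> v $ 2 = 0" by simp
next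
  assume v: "v $ 1 = 0 \<and> v $ 2 = 0"
  then have "v = v $ 3 *s vector [0, 0, 1]" by (simp add: vec3_eq_iff)
  moreover have "v $ 3 \<noteq> 0" using v assms by (simp add: vec3_eq_iff)
  ultimately show "vec.span {v} = nucleus"
    unfolding nucleus_def using span_singleton_scale by metis
qed

lemma span_mem_conic_arc:
  assumes "v \<noteq> 0"
  shows "vec.span {v} \<in> conic_arc C \<longleftrightarrow> (v $ 1 = 0 \<and> v $ 2 = 0) \<or> (\<exists>c\<in>C. conic_form c v = 0)"
  using assms by (simp add: conic_arc_def span_eq_nucleus span_mem_conic_points)

lemma conic_arcE:
  assumes "P \<in> conic_arc C"
  obtains v where "v \<noteq> 0" "P = vec.span {v}"
proof -
  have "vector [0, 0, 1] \<noteq> (0 :: 'a ^ 3)" by (simp add: vec3_eq_iff)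
  then show thesis using assms that by (auto simp: conic_arc_def conic_points_eq nucleus_def)
qed

lemma image_span_semilinear:
  fixes f :: "'a::field ^ 'n \<Rightarrow> 'a ^ 'm"
  assumes "\<And>k v. f (k *s v) = \<sigma> k *s f v" "surj \<sigma>"
  shows "f ` vec.span {v} = vec.span {f v}"
proof -
  have "f ` vec.span {v} = (\<lambda>k. k *s f v) ` range \<sigma>"
    by (simp add: vec.span_singleton image_image assms(1))
  then show ?thesis by (simp add: vec.span_singleton assms(2))
qed

text \<open>Stated for semilinear f to cover both coordinate changes (\<open>\<sigma>\<close> the
  identity) and field automorphisms. \<open>h\<close> records the action on coefficient triples; the
  forms have to share only their zeros, so that proportional equations are allowed.\<close>

lemma image_conic_arc:
  fixes f :: "'a::{field,finite} ^ 3 \<Rightarrow> 'a ^ 3"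
  assumes scale: "\<And>k v. f (k *s v) = \<sigma> k *s f v" and "surj \<sigma>"
    and "surj f" and zero: "\<And>v. f v = 0 \<longleftrightarrow> v = 0"
    and nuc: "\<And>v. (f v) $ 1 = 0 \<and> (f v) $ 2 = 0 \<longleftrightarrow> v $ 1 = 0 \<and> v $ 2 = 0"
    and form: "\<And>c v. c \<in> C \<Longrightarrow> conic_form (h c) (f v) = 0 \<longleftrightarrow> conic_form c v = 0"
  shows "image f ` conic_arc C = conic_arc (h ` C)"
proof -
  have span: "f ` vec.span {v} = vec.span {f v}" for v
    by (rule image_span_semilinear) fact+
  have mem: "vec.span {f v} \<in> conic_arc (h ` C) \<longleftrightarrow> vec.span {v} \<in> conic_arc C" if "v \<noteq> 0" for v
    using that by (simp add: span_mem_conic_arc zero nuc form)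
  show ?thesis
  proof (intro equalityI subsetI)
    fix P assume "P \<in> image f ` conic_arc C"
    then obtain Q where "Q \<in> conic_arc C" "P = f ` Q" by blast
    moreover then obtain v where "v \<noteq> 0" "Q = vec.span {v}" by (elim conic_arcE)
    ultimately have "v \<noteq> 0" "vec.span {v} \<in> conic_arc C" "P = f ` vec.span {v}" by simp_all
    then show "P \<in> conic_arc (h ` C)" by (simp add: span mem)
  next
    fix P assume P: "P \<in> conic_arc (h ` C)"
    then obtain w where "w \<noteq> 0" "P = vec.span {w}" by (rule conic_arcE)
    moreover obtain v where "w = f v" using \<open>surj f\<close> by (meson surjD)
    ultimately have "v \<noteq> 0" "P = f ` vec.span {v}" "vec.span {v} \<in> conic_arc C"
      using P zero mem by (auto simp: span)
    then show "P \<in> image f ` conic_arc C" by blast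
  qed
qed

section \<open>Semilinear maps and the equivalence relation \<open>arc_iso\<close>\<close>

definition map_vec :: "('a \<Rightarrow> 'a) \<Rightarrow> 'a ^ 'n \<Rightarrow> 'a ^ 'n" where
  "map_vec \<sigma> v = (\<chi> i. \<sigma> (v $ i))"

lemma field_automorphism_0 [simp]: "field_automorphism \<sigma> \<Longrightarrow> \<sigma> 0 = 0"
  unfolding field_automorphism_def by (metis add_cancel_right_right)

lemma field_automorphism_eq_0 [simp]: "field_automorphism \<sigma> \<Longrightarrow> \<sigma> x = 0 \<longleftrightarrow> x = 0"
  by (metis field_automorphism_0 field_automorphism_def bij_pointE)

lemma field_automorphism_1 [simp]:
  assumes "field_automorphism \<sigma>"
  shows "\<sigma> 1 = 1"
proof -
  have "\<sigma> 1 * \<sigma> 1 = \<sigma> (1 * 1)" using assms unfolding field_automorphism_def by metis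
  then show ?thesis using assms by simp
qed

lemma field_automorphism_power: "field_automorphism \<sigma> \<Longrightarrow> \<sigma> (x ^ n) = \<sigma> x ^ n"
  by (induction n) (auto simp: field_automorphism_def[of \<sigma>])

lemma field_automorphism_sum: "field_automorphism \<sigma> \<Longrightarrow> \<sigma> (sum f A) = (\<Sum>x\<in>A. \<sigma> (f x))"
  by (induction A rule: infinite_finite_induct) (auto simp: field_automorphism_def[of \<sigma>])

lemma field_automorphism_id: "field_automorphism id"
  by (simp add: field_automorphism_def)

lemma field_automorphism_comp:
  "field_automorphism \<sigma> \<Longrightarrow> field_automorphism \<tau> \<Longrightarrow> field_automorphism (\<sigma> \<circ> \<tau>)"
  by (auto simp: field_automorphism_def bij_comp)

lemma field_automorphism_inv:
  assumes "field_automorphism \<sigma>"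
  shows "field_automorphism (inv \<sigma>)"
proof -
  have "bij \<sigma>" using assms by (simp add: field_automorphism_def)
  then have eq: "inv \<sigma> x = y \<longleftrightarrow> x = \<sigma> y" for x y
    using bij_inv_eq_iff[OF \<open>bij \<sigma>\<close>, of y x] by auto
  have "\<sigma> (inv \<sigma> x) = x" for x using eq by metis
  then have "inv \<sigma> (x + y) = inv \<sigma> x + inv \<sigma> y" "inv \<sigma> (x * y) = inv \<sigma> x * inv \<sigma> y" for x y
    using assms by (simp_all add: eq field_automorphism_def)
  then show ?thesis using \<open>bij \<sigma>\<close> by (simp add: field_automorphism_def bij_imp_bij_inv)
qed

text \<open>The matrix on the right is M with \<open>\<sigma>\<close> applied to each entry. This
  commutation rule is behind both composition and inversion of semilinear maps.\<close>

lemma map_vec_mult: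
  fixes M :: "'a::field ^ 'n ^ 'm"
  assumes "field_automorphism \<sigma>"
  shows "map_vec \<sigma> (M *v v) = (\<chi> i. map_vec \<sigma> (M $ i)) *v map_vec \<sigma> v"
  using assms by (simp add: map_vec_def matrix_vector_mult_def vec_eq_iff field_automorphism_sum)
     (simp add: field_automorphism_def)

lemma invertible_map_matrix:
  fixes M :: "'a::field ^ 'n ^ 'n"
  assumes "field_automorphism \<sigma>" "invertible M"
  shows "invertible (\<chi> i. map_vec \<sigma> (M $ i))"
proof -
  obtain N where "M ** N = mat 1" "N ** M = mat 1" using assms(2) by (auto simp: invertible_def)
  moreover have "(\<chi> i. map_vec \<sigma> (A $ i)) ** (\<chi> i. map_vec \<sigma> (B $ i)) = mat 1"
    if "A ** B = mat 1" for A B :: "'a ^ 'n ^ 'n"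
  proof -
    have "(\<chi> i. map_vec \<sigma> (A $ i)) ** (\<chi> i. map_vec \<sigma> (B $ i)) = (\<chi> i. map_vec \<sigma> ((A ** B) $ i))"
      using assms(1) by (simp add: map_vec_def matrix_matrix_mult_def vec_eq_iff field_automorphism_sum)
        (simp add: field_automorphism_def)
    also have "\<dots> = mat 1" using assms(1) by (simp add: that map_vec_def mat_def vec_eq_iff)
    finally show ?thesis .
  qed
  ultimately show ?thesis unfolding invertible_def by blast
qed

lemma arc_iso_iff:
  "(K, K') \<in> arc_iso \<longleftrightarrow>
    (\<exists>M \<sigma>. invertible M \<and> field_automorphism \<sigma> \<and> image (\<lambda>v. M *v map_vec \<sigma> v) ` K = K')"
  by (auto simp: arc_iso_def PGammaL3_def map_vec_def)

lemma arc_iso_PGL3: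
  fixes M :: "'a::{field,finite} ^ 3 ^ 3"
  assumes "invertible M" "image ((*v) M) ` K = K'"
  shows "(K, K') \<in> arc_iso"
proof -
  have "map_vec id = (\<lambda>v :: 'a ^ 3. v)" by (simp add: map_vec_def fun_eq_iff)
  then have "image (\<lambda>v. M *v map_vec id v) ` K = K'" using assms(2) by simp
  then show ?thesis unfolding arc_iso_iff using assms(1) field_automorphism_id by blast
qed

lemma equiv_arc_iso: "equiv UNIV (arc_iso :: (('a::{field,finite} ^ 3) set set \<times> _) set)"
proof (rule equivI)
  have "invertible (mat 1 :: 'a ^ 3 ^ 3)" by (simp add: invertible_def) 
  then show "refl (arc_iso :: (('a ^ 3) set set \<times> _) set)"
    by (auto intro!: refl_onI arc_iso_PGL3[of "mat 1"] simp: image_def)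
  show "sym (arc_iso :: (('a ^ 3) set set \<times> _) set)"
  proof (rule symI)
    fix K K' :: "('a ^ 3) set set"
    assume "(K, K') \<in> arc_iso"
    then obtain M \<sigma> where *: "invertible M" "field_automorphism \<sigma>" "image (\<lambda>v. M *v map_vec \<sigma> v) ` K = K'"
      unfolding arc_iso_iff by blast
    obtain N where N: "N ** M = mat 1" "M ** N = mat 1" using *(1) by (auto simp: invertible_def)
    then have "invertible N" by (auto simp: invertible_def)
    define \<tau> where "\<tau> = inv \<sigma>"
    \<comment> \<open>The inverse of v -> M \<sigma>(v) is w -> N' \<tau>(w), where N' arises from
      the inverse matrix by applying \<tau> to its entries.\<close>
    define N' where "N' = (\<chi> i. map_vec \<tau> (N $ i))"
    have \<tau>: "field_automorphism \<tau>" unfolding \<tau>_def by (rule field_automorphism_inv) fact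
    have N': "invertible N'" unfolding N'_def by (rule invertible_map_matrix) fact+
    have inv: "N' *v map_vec \<tau> (M *v map_vec \<sigma> v) = v" for v
    proof -
      have "N' *v map_vec \<tau> (M *v map_vec \<sigma> v) = map_vec \<tau> (N *v (M *v map_vec \<sigma> v))"
        by (simp add: N'_def map_vec_mult \<tau>)
      also have "\<dots> = map_vec \<tau> (map_vec \<sigma> v)" by (simp add: matrix_vector_mul_assoc N)
      also have "\<dots> = v" using *(2)
        by (simp add: map_vec_def \<tau>_def field_automorphism_def bij_is_inj vec_eq_iff)
      finally show ?thesis .
    qed
    have "image (\<lambda>v. N' *v map_vec \<tau> v) ` K' = K"
      unfolding *(3)[symmetric] by (simp add: image_image inv)
    then show "(K', K) \<in> arc_iso" unfolding arc_iso_iff using N' \<tau> by blast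
  qed
  show "trans (arc_iso :: (('a ^ 3) set set \<times> _) set)"
  proof (rule transI)
    fix K K' K'' :: "('a ^ 3) set set"
    assume "(K, K') \<in> arc_iso" "(K', K'') \<in> arc_iso"
    then obtain M \<sigma> N \<tau> where *: "invertible M" "field_automorphism \<sigma>" "image (\<lambda>v. M *v map_vec \<sigma> v) ` K = K'"
      and **: "invertible N" "field_automorphism \<tau>" "image (\<lambda>v. N *v map_vec \<tau> v) ` K' = K''"
      unfolding arc_iso_iff by blast
    define M' where "M' = (\<chi> i. map_vec \<tau> (M $ i))"
    have "N *v map_vec \<tau> (M *v map_vec \<sigma> v) = (N ** M') *v map_vec (\<tau> \<circ> \<sigma>) v" for v
      by (simp add: map_vec_mult ** M'_def flip: matrix_vector_mul_assoc) (simp add: map_vec_def)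
    then have "image (\<lambda>v. (N ** M') *v map_vec (\<tau> \<circ> \<sigma>) v) ` K = K''"
      unfolding **(3)[symmetric] *(3)[symmetric] by (simp add: image_image)
    moreover have "invertible (N ** M')" unfolding M'_def
      by (intro invertible_mult invertible_map_matrix * **)
    moreover have "field_automorphism (\<tau> \<circ> \<sigma>)" by (intro field_automorphism_comp * **)
    ultimately show "(K, K'') \<in> arc_iso" unfolding arc_iso_iff by blast
  qed
qed auto

section \<open>Linear maps between two conic arcs\<close>

context gf32 begin

text \<open>Some conic of \<open>C2\<close>, pulled back along M, shares so many points with the
  given conic that the two equations are proportional. The factor is D because both equations have x
  y coefficient 1 and, once the nucleus is fixed, M multiplies that coefficient by D.\<close>

lemma conic_arc_rigidity:
  fixes M :: "'a ^ 3 ^ 3"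
  defines "D \<equiv> M $ 1 $ 1 * M $ 2 $ 2 + M $ 1 $ 2 * M $ 2 $ 1"
  assumes inv: "invertible M" and sub: "image ((*v) M) ` conic_arc C1 \<subseteq> conic_arc C2"
    and card_C2: "card C2 \<le> 7" and c1: "(\<alpha>, \<beta>, l) \<in> C1" and l: "l \<noteq> 0"
  shows "M $ 1 $ 3 = 0 \<and> M $ 2 $ 3 = 0 \<and> M $ 3 $ 3 \<noteq> 0 \<and> D \<noteq> 0 \<and>
    (\<exists>(\<alpha>', \<beta>', l') \<in> C2. l' * (M $ 3 $ 3)\<^sup>2 = D * l \<and>
       \<alpha>' * (M $ 1 $ 1)\<^sup>2 + M $ 1 $ 1 * M $ 2 $ 1 + \<beta>' * (M $ 2 $ 1)\<^sup>2 + l' * (M $ 3 $ 1)\<^sup>2 = D * \<alpha> \<and>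
       \<alpha>' * (M $ 1 $ 2)\<^sup>2 + M $ 1 $ 2 * M $ 2 $ 2 + \<beta>' * (M $ 2 $ 2)\<^sup>2 + l' * (M $ 3 $ 2)\<^sup>2 = D * \<beta>)"
proof -
  \<comment> \<open>The points \<open>v t\<close> parametrise the conic quadratically (up to one point), so another conic
    restricts to a quartic polynomial in \<open>t\<close>.\<close>
  obtain a b c where abc: "a\<^sup>2 = \<alpha> / l" "b\<^sup>2 = \<beta> / l" "c\<^sup>2 = 1 / l"
    using square_surj by metis
  have c: "c \<noteq> 0" using abc(3) l by auto
  define v :: "'a \<Rightarrow> 'a ^ 3" where "v t = vector [1, t\<^sup>2, a + c * t + b * t\<^sup>2]" for t
  define N where "N = {t. (M *v v t) $ 1 = 0 \<and> (M *v v t) $ 2 = 0}"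
  have inj: "M *v x = 0 \<longleftrightarrow> x = 0" for x
    using inv by (metis invertible_def matrix_left_invertible_ker matrix_vector_mult_0_right)
  have v0: "v t \<noteq> 0" for t by (simp add: v_def vec3_eq_iff)
  have on_c1: "conic_form (\<alpha>, \<beta>, l) (v t) = 0" for t
  proof -
    have "conic_form (\<alpha>, \<beta>, l) (v t) = \<alpha> + t\<^sup>2 + \<beta> * t ^ 4 + l * (a\<^sup>2 + c\<^sup>2 * t\<^sup>2 + b\<^sup>2 * t ^ 4)"
      by (simp add: conic_form_def v_def square_add power_mult_distrib flip: power_mult)
    also have "\<dots> = 0" using l by (simp add: abc field_simps char_2)
    finally show ?thesis .
  qed
  have "vec.span {M *v v t} \<in> conic_arc C2" for t
  proof -
    have "vec.span {v t} \<in> conic_arc C1" using c1 on_c1 v0 span_mem_conic_arc by blast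
    moreover have "((*v) M) ` vec.span {v t} = vec.span {M *v v t}"
      by (rule image_span_semilinear[where \<sigma> = id]) (simp_all add: vec.scale)
    ultimately show ?thesis using sub by (metis image_subset_iff)
  qed
  then have cover: "UNIV \<subseteq> N \<union> (\<Union>c\<in>C2. {t. conic_form c (M *v v t) = 0})"
    by (auto simp: N_def span_mem_conic_arc inj v0)
  have "card N \<le> 1"
  proof (rule ccontr)
    assume "\<not> card N \<le> 1"
    then obtain s t where st: "s \<in> N" "t \<in> N" "s \<noteq> t"
      by (metis card_le_Suc0_iff_eq finite One_nat_def)
    have "vec.span {M *v v x} = nucleus" if "x \<in> N" for x
      using that by (subst span_eq_nucleus) (simp_all add: inj v0 N_def)
    then have "vec.span {M *v v s} = vec.span {M *v v t}" using st(1,2) by simp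
    then obtain k where k: "M *v v s = k *s (M *v v t)"
      using span_singleton_eqD inj v0 by metis
    then have "M *v (v s - k *s v t) = 0" by (simp add: vec.diff vec.scale)
    then have "v s = k *s v t" by (simp add: inj)
    then have "s\<^sup>2 = t\<^sup>2" by (simp add: v_def vec3_eq_iff)
    then show False using st(3) by (simp add: square_inj)
  qed
  \<comment> \<open>The parametrisation misses the point of the conic with x = 0, which leaves 32
    parameters for its 33 points; 1 + 7 * 4 = 29 is still too small.\<close>
  have "\<exists>c\<in>C2. 4 < card {t. conic_form c (M *v v t) = 0}"
  proof (rule ccontr)
    assume "\<not> ?thesis"
    then have "(\<Sum>c\<in>C2. card {t. conic_form c (M *v v t) = 0}) \<le> card C2 * 4"
      by (intro sum_bounded_above[THEN order_trans]) (auto simp: not_less)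
    moreover have "card (UNIV::'a set) \<le> card (N \<union> (\<Union>c\<in>C2. {t. conic_form c (M *v v t) = 0}))"
      using cover by (intro card_mono) auto
    then have "card (UNIV::'a set) \<le> card N + card (\<Union>c\<in>C2. {t. conic_form c (M *v v t) = 0})"
      by (rule order_trans[OF _ card_Un_le])
    then have "card (UNIV::'a set) \<le> card N + (\<Sum>c\<in>C2. card {t. conic_form c (M *v v t) = 0})"
      by (rule order_trans) (intro add_left_mono card_UN_le finite)
    ultimately show False using \<open>card N \<le> 1\<close> card_C2 card_field by linarith
  qed
  then obtain \<alpha>' \<beta>' l' where c2: "(\<alpha>', \<beta>', l') \<in> C2"
    and many: "4 < card {t. conic_form (\<alpha>', \<beta>', l') (M *v v t) = 0}" by auto
  \<comment> \<open>A, B, G are the coefficients of x^2, y^2, z^2 in the pulled back equation, and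
    D, E, H those of x y, y z, x z.\<close>
  define A where "A = \<alpha>' * (M $ 1 $ 1)\<^sup>2 + M $ 1 $ 1 * M $ 2 $ 1 + \<beta>' * (M $ 2 $ 1)\<^sup>2 + l' * (M $ 3 $ 1)\<^sup>2"
  define B where "B = \<alpha>' * (M $ 1 $ 2)\<^sup>2 + M $ 1 $ 2 * M $ 2 $ 2 + \<beta>' * (M $ 2 $ 2)\<^sup>2 + l' * (M $ 3 $ 2)\<^sup>2"
  define G where "G = \<alpha>' * (M $ 1 $ 3)\<^sup>2 + M $ 1 $ 3 * M $ 2 $ 3 + \<beta>' * (M $ 2 $ 3)\<^sup>2 + l' * (M $ 3 $ 3)\<^sup>2"
  define E where "E = M $ 1 $ 2 * M $ 2 $ 3 + M $ 1 $ 3 * M $ 2 $ 2"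
  define H where "H = M $ 1 $ 1 * M $ 2 $ 3 + M $ 1 $ 3 * M $ 2 $ 1"
  have "conic_form (\<alpha>', \<beta>', l') (M *v v t) = (A + G * a\<^sup>2 + H * a) + (H * c) * t
     + (G * c\<^sup>2 + D + E * a + H * b) * t ^ 2 + (E * c) * t ^ 3 + (B + G * b\<^sup>2 + E * b) * t ^ 4" for t
    unfolding A_def B_def G_def E_def H_def D_def conic_form_def
    by (simp add: matrix_vector_mult_def sum_3 v_def power2_eq_square power3_eq_cube power4_eq_xxxx
        algebra_simps char_2)
  then have "A + G * a\<^sup>2 + H * a = 0 \<and> H * c = 0 \<and> G * c\<^sup>2 + D + E * a + H * b = 0 \<and> E * c = 0 \<and>
      B + G * b\<^sup>2 + E * b = 0"
    using many by (intro quartic_eq_0) simp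
  then have HE: "H = 0" "E = 0" and ABD: "A = G * a\<^sup>2" "B = G * b\<^sup>2" "D = G * c\<^sup>2"
    using c by (auto simp: add_eq_0_char2)
  \<comment> \<open>(E, H, D) is the cross product of the first two rows of M: its product with the
    third row is the determinant, with either of the first two it is 0.\<close>
  have "det M = M $ 3 $ 1 * E + M $ 3 $ 2 * H + M $ 3 $ 3 * D"
    by (simp add: det_3 E_def H_def D_def algebra_simps char_2)
  then have D: "M $ 3 $ 3 \<noteq> 0" "D \<noteq> 0" using inv HE by (auto simp: invertible_det_nz)
  have "M $ 1 $ 3 * D = M $ 1 $ 1 * E + M $ 1 $ 2 * H" "M $ 2 $ 3 * D = M $ 2 $ 1 * E + M $ 2 $ 2 * H"
    by (simp_all add: E_def H_def D_def algebra_simps char_2)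
  then have M: "M $ 1 $ 3 = 0" "M $ 2 $ 3 = 0" using HE D by auto
  then have G: "G = l' * (M $ 3 $ 3)\<^sup>2" by (simp add: G_def)
  have "G = D * l" "A = D * \<alpha>" "B = D * \<beta>" using ABD abc l by simp_all
  then show ?thesis using M D c2 unfolding A_def B_def G by (intro conjI bexI[OF _ c2]) auto
qed

end

section \<open>The arcs with \<open>\<alpha> = 1\<close> and \<open>\<beta> = 1 + \<lambda>\<^sup>3\<close>\<close>

declare conic_points.simps [simp del]

section \<open>Lines of the plane\<close>

lemma pg_lines_hyperplane:
  fixes L :: "('a::{field,finite} ^ 3) set"
  assumes "L \<in> pg_lines"
  obtains n :: "'a ^ 3" where "n \<noteq> 0" "L = {v. n $ 1 * v $ 1 + n $ 2 * v $ 2 + n $ 3 * v $ 3 = 0}"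
proof -
  have L: "vec.subspace L" "vec.dim L = 2" using assms by (auto simp: pg_lines_def)
  obtain B where B: "B \<subseteq> L" "L \<subseteq> vec.span B" "card B = 2"
    using vec.basis_exists L(2) by metis
  then obtain u w where uw: "B = {u, w}" by (meson card_2_iff)
  \<comment> \<open>The zero third row makes R singular; a kernel vector is orthogonal to u and w,
    hence a normal vector of L.\<close>
  define R :: "'a ^ 3 ^ 3" where "R = vector [u, w, 0]"
  have "det R = 0" by (simp add: det_3 R_def)
  then have "\<not> (\<exists>S. S ** R = mat 1)"
    using invertible_det_nz invertible_left_inverse by blast
  then have "\<not> (\<forall>x. R *v x = 0 \<longrightarrow> x = 0)" unfolding matrix_left_invertible_ker .
  then obtain n where n: "n \<noteq> 0" "R *v n = 0" by blast
  define H where "H = {v :: 'a ^ 3. n $ 1 * v $ 1 + n $ 2 * v $ 2 + n $ 3 * v $ 3 = 0}"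
  have H: "vec.subspace H"
  proof (rule vec.subspaceI)
    fix x y assume "x \<in> H" "y \<in> H"
    moreover have "n $ 1 * (x + y) $ 1 + n $ 2 * (x + y) $ 2 + n $ 3 * (x + y) $ 3
      = (n $ 1 * x $ 1 + n $ 2 * x $ 2 + n $ 3 * x $ 3) + (n $ 1 * y $ 1 + n $ 2 * y $ 2 + n $ 3 * y $ 3)"
      by (simp add: algebra_simps)
    ultimately show "x + y \<in> H" by (simp only: H_def mem_Collect_eq add_0)
  next
    fix k x assume "x \<in> H"
    moreover have "n $ 1 * (k *s x) $ 1 + n $ 2 * (k *s x) $ 2 + n $ 3 * (k *s x) $ 3
      = k * (n $ 1 * x $ 1 + n $ 2 * x $ 2 + n $ 3 * x $ 3)"
      by (simp add: algebra_simps)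
    ultimately show "k *s x \<in> H" by (simp only: H_def mem_Collect_eq mult_zero_right)
  qed (simp add: H_def)
  have "u \<in> H" "w \<in> H"
    using n(2) by (simp_all add: vec3_eq_iff matrix_vector_mult_def sum_3 R_def H_def mult.commute)
  then have "vec.span B \<subseteq> H" using H by (intro vec.span_minimal) (auto simp: uw)
  then have sub: "L \<subseteq> H" using B by blast
  have "H \<noteq> UNIV"
  proof
    assume "H = UNIV"
    then have "vector [1, 0, 0] \<in> H" "vector [0, 1, 0] \<in> H" "vector [0, 0, 1] \<in> H" by simp_all
    then show False using n(1) by (simp add: H_def vec3_eq_iff)
  qed
  then have "vec.dim H < vec.dim (UNIV :: ('a ^ 3) set)"
    using H by (intro vec.dim_psubset) (metis vec.span_UNIV vec.span_eq_iff psubsetI subset_UNIV)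
  then have "vec.dim H \<le> vec.dim L" by (simp only: L vec_dim_card) simp
  then have "L = H" using vec.subspace_dim_equal[OF L(1) H sub] by simp
  then show thesis using that n(1) H_def by blast
qed

lemma image_pg_lines:
  fixes M :: "'a::{field,finite} ^ 3 ^ 3"
  assumes "invertible M" "L \<in> pg_lines"
  shows "((*v) M) ` L \<in> pg_lines"
proof -
  have inj: "inj ((*v) M)"
    using assms(1) by (metis invertible_def matrix_left_invertible_injective)
  have "vec.dim (((*v) M) ` L) = vec.dim L"
    using inj by (intro vec.dim_image_eq) (auto intro: inj_on_subset)
  then show ?thesis
    using assms(2) by (auto simp: pg_lines_def intro: vec.subspace_image)
qed

text \<open>The test line through the nucleus on which the degree of an arc is read off.\<close>

lemma nucleus_line: "{v :: 'a::{field,finite} ^ 3. v $ 2 = 0} \<in> pg_lines"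
proof -
  have "{v :: 'a ^ 3. v $ 2 = 0} = {v. \<forall>i. i \<notin> {1, 3} \<longrightarrow> v $ i = 0}"
    by (simp add: forall_3)
  also have "vec.dim \<dots> = card {1, 3 :: 3}" by (rule dim_substandard_cart)
  finally have "vec.dim {v :: 'a ^ 3. v $ 2 = 0} = 2" by simp
  then show ?thesis
    by (auto simp: pg_lines_def vec.subspace_def)
qed

lemma span_subset_iff:
  fixes S :: "('a::field ^ 'n) set"
  shows "vec.subspace S \<Longrightarrow> vec.span {v} \<subseteq> S \<longleftrightarrow> v \<in> S"
  using vec.span_minimal[of "{v}" S] vec.span_base[of v "{v}"] by auto

lemma span_mem_pg_points: "v \<noteq> 0 \<Longrightarrow> vec.span {v} \<in> pg_points"
  by (simp add: pg_points_def vec.subspace_span)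

text \<open>Members of a closed set have distinct \<lambda>, so \<alpha> and \<beta> are functions
  of \<lambda>. Removing 0 here lets A itself be a subgroup.\<close>

definition conic_family :: "('a \<Rightarrow> 'a) \<Rightarrow> ('a \<Rightarrow> 'a) \<Rightarrow> 'a set \<Rightarrow> ('a::{field,finite} \<times> 'a \<times> 'a) set" where
  "conic_family p r A = (\<lambda>l. (p l, r l, l)) ` (A - {0})"

definition additive_subgroup :: "'a::ab_group_add set \<Rightarrow> bool" where
  "additive_subgroup A \<longleftrightarrow> 0 \<in> A \<and> (\<forall>x\<in>A. \<forall>y\<in>A. x - y \<in> A)"

context gf32 begin

lemma additive_subgroup_iff:
  "additive_subgroup (A :: 'a set) \<longleftrightarrow> 0 \<in> A \<and> (\<forall>x\<in>A. \<forall>y\<in>A. x + y \<in> A)"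
  by (simp add: additive_subgroup_def diff_eq)

text \<open>The form Tr(x y (x + y)) is the polarisation of the GF(2)-quadratic form
  Tr(x^3).\<close>

definition isotropic :: "'a set \<Rightarrow> bool" where
  "isotropic A \<longleftrightarrow> additive_subgroup A \<and> card A = 8 \<and> (\<forall>x\<in>A. \<forall>y\<in>A. Tr (x * y * (x + y)) = 0)"

text \<open>At \<lambda> = 1 this has \<beta> = 0, so it is not closed once 1 is in A;
  \<open>mathon_type_mathon_conics\<close> passes to a closed set by another choice of
  coordinates.\<close>

definition mathon_conics :: "'a set \<Rightarrow> ('a \<times> 'a \<times> 'a) set" where
  "mathon_conics = conic_family (\<lambda>_. 1) (\<lambda>l. 1 + l ^ 3)"

text \<open>M has rows (a, b, 0), (c, d, 0), (e, f, r), the shape that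
  \<open>conic_arc_rigidity\<close> forces. The equations in the hypothesis say that the new conic,
  pulled back along M, is D times the old one, D being the x y coefficient of the pullback.\<close>

lemma conic_arc_transform:
  fixes a b c d e f r :: 'a
  defines "D \<equiv> a * d + b * c"
  assumes "D \<noteq> 0" "r \<noteq> 0"
    and h: "\<And>\<alpha> \<beta> l. (\<alpha>, \<beta>, l) \<in> C \<Longrightarrow> \<exists>\<alpha>' \<beta>' l'. h (\<alpha>, \<beta>, l) = (\<alpha>', \<beta>', l') \<and>
      \<alpha>' * a\<^sup>2 + a * c + \<beta>' * c\<^sup>2 + l' * e\<^sup>2 = D * \<alpha> \<and>
      \<alpha>' * b\<^sup>2 + b * d + \<beta>' * d\<^sup>2 + l' * f\<^sup>2 = D * \<beta> \<and> l' * r\<^sup>2 = D * l"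
  obtains M :: "'a ^ 3 ^ 3" where "invertible M" "image ((*v) M) ` conic_arc C = conic_arc (h ` C)"
proof
  define M :: "'a ^ 3 ^ 3" where "M = vector [vector [a, b, 0], vector [c, d, 0], vector [e, f, r]]"
  have Mv: "(M *v v) $ 1 = a * v $ 1 + b * v $ 2" "(M *v v) $ 2 = c * v $ 1 + d * v $ 2"
    "(M *v v) $ 3 = e * v $ 1 + f * v $ 2 + r * v $ 3" for v
    by (simp_all add: M_def matrix_vector_mult_def sum_3)
  have "det M = D * r" by (simp add: M_def det_3 D_def algebra_simps char_2)
  then show inv: "invertible M" using assms(2,3) by (simp add: invertible_det_nz)
  then obtain N where N: "N ** M = mat 1" "M ** N = mat 1" by (auto simp: invertible_def)
  show "image ((*v) M) ` conic_arc C = conic_arc (h ` C)"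
  proof (rule image_conic_arc[where \<sigma> = id])
    show "surj ((*v) M)"
      by (rule surjI[of _ "(*v) N"]) (simp add: matrix_vector_mul_assoc N)
    show "M *v v = 0 \<longleftrightarrow> v = 0" for v
      using N(1) matrix_left_invertible_ker by fastforce
    show "(M *v v) $ 1 = 0 \<and> (M *v v) $ 2 = 0 \<longleftrightarrow> v $ 1 = 0 \<and> v $ 2 = 0" for v
    proof
      assume "(M *v v) $ 1 = 0 \<and> (M *v v) $ 2 = 0"
      \<comment> \<open>Multiplication by the adjugate of the upper left 2 x 2 block.\<close>
      then have "d * (M *v v) $ 1 + b * (M *v v) $ 2 = 0" "c * (M *v v) $ 1 + a * (M *v v) $ 2 = 0" by simp_all
      then have "D * v $ 1 = 0" "D * v $ 2 = 0" by (simp_all add: Mv D_def algebra_simps char_2)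
      then show "v $ 1 = 0 \<and> v $ 2 = 0" using assms(2) by simp
    qed (simp add: Mv)
    fix x v assume "x \<in> C"
    obtain \<alpha> \<beta> l where x: "x = (\<alpha>, \<beta>, l)" by (cases x)
    obtain \<alpha>' \<beta>' l' where hx: "h x = (\<alpha>', \<beta>', l')"
      and eq: "\<alpha>' * a\<^sup>2 + a * c + \<beta>' * c\<^sup>2 + l' * e\<^sup>2 = D * \<alpha>"
        "\<alpha>' * b\<^sup>2 + b * d + \<beta>' * d\<^sup>2 + l' * f\<^sup>2 = D * \<beta>" "l' * r\<^sup>2 = D * l"
      using h \<open>x \<in> C\<close> x by metis
    have "conic_form (h x) (M *v v) =
       (\<alpha>' * a\<^sup>2 + a * c + \<beta>' * c\<^sup>2 + l' * e\<^sup>2) * (v $ 1)\<^sup>2 + D * (v $ 1 * v $ 2)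
     + (\<alpha>' * b\<^sup>2 + b * d + \<beta>' * d\<^sup>2 + l' * f\<^sup>2) * (v $ 2)\<^sup>2 + (l' * r\<^sup>2) * (v $ 3)\<^sup>2"
      unfolding hx by (simp add: conic_form_def Mv square_add power_mult_distrib D_def)
        (simp add: algebra_simps power2_eq_square char_2)
    also have "\<dots> = D * conic_form x v"
      unfolding eq by (simp add: x conic_form_def algebra_simps)
    finally show "conic_form (h x) (M *v v) = 0 \<longleftrightarrow> conic_form x v = 0"
      using assms(2) by simp
  qed (simp_all add: vec.scale)
qed

section \<open>Common points of two conics\<close>

lemma conic_form_common_zero:
  assumes "conic_form (\<alpha>, \<beta>, l) v = 0" "conic_form (\<alpha>', \<beta>', l') v = 0"
  shows "(l' * \<alpha> + l * \<alpha>') * (v $ 1)\<^sup>2 + (l + l') * v $ 1 * v $ 2 + (l' * \<beta> + l * \<beta>') * (v $ 2)\<^sup>2 = (0::'a)"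
proof -
  have "(l' * \<alpha> + l * \<alpha>') * (v $ 1)\<^sup>2 + (l + l') * v $ 1 * v $ 2 + (l' * \<beta> + l * \<beta>') * (v $ 2)\<^sup>2
    = l' * conic_form (\<alpha>, \<beta>, l) v + l * conic_form (\<alpha>', \<beta>', l') v"
    by (simp add: conic_form_def algebra_simps char_2)
  then show ?thesis by (simp add: assms)
qed

text \<open>
  Eliminating \<open>z\<close> from two conics leaves the binary quadratic form of \<open>conic_form_common_zero\<close>, which is
  anisotropic iff this trace is 1.
\<close>

definition disjointness_trace :: "'a \<times> 'a \<times> 'a \<Rightarrow> 'a \<times> 'a \<times> 'a \<Rightarrow> 'a" where
  "disjointness_trace = (\<lambda>(\<alpha>, \<beta>, l) (\<alpha>', \<beta>', l').
     Tr ((l' * \<alpha> + l * \<alpha>') * (l' * \<beta> + l * \<beta>') / (l + l')\<^sup>2))"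

lemma conic_points_disjointI:
  assumes "disjointness_trace (\<alpha>, \<beta>, l) (\<alpha>', \<beta>', l') = 1" "l \<noteq> l'" "l \<noteq> 0"
  shows "conic_points (\<alpha>, \<beta>, l) \<inter> conic_points (\<alpha>', \<beta>', l') = {}"
proof (rule ccontr)
  assume "\<not> ?thesis"
  then obtain P where P: "P \<in> conic_points (\<alpha>, \<beta>, l)" "P \<in> conic_points (\<alpha>', \<beta>', l')" by blast
  then obtain v where v: "v \<noteq> 0" "P = vec.span {v}" "conic_form (\<alpha>, \<beta>, l) v = 0"
    by (auto simp: conic_points_eq)
  with P have v': "conic_form (\<alpha>', \<beta>', l') v = 0" using span_mem_conic_points by blast
  define A where "A = l' * \<alpha> + l * \<alpha>'"
  define B where "B = (l' * \<beta> + l * \<beta>') / (l + l')\<^sup>2"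
  have s: "l + l' \<noteq> 0" using assms(2) by (simp add: add_eq_0_char2)
  have "A * (v $ 1)\<^sup>2 + (l + l') * v $ 1 * v $ 2 + (l + l')\<^sup>2 * B * (v $ 2)\<^sup>2 = 0"
    using conic_form_common_zero[OF v(3) v'] s by (simp add: A_def B_def)
  moreover have "Tr (A * B) = 1"
    using assms(1) by (simp add: A_def B_def disjointness_trace_def)
  ultimately have "v $ 1 = 0 \<and> v $ 2 = 0" using quadratic_anisotropic s by blast
  then have "v = 0" using v(3) assms(3) by (simp add: conic_form_def vec3_eq_iff)
  then show False using v(1) by simp
qed

text \<open>Every element has a square root, so a nontrivial zero (x, y) of the form without z lifts
  to a point of the first conic; it then lies on the second as well.\<close>

lemma conic_points_disjointD:
  assumes "conic_points (\<alpha>, \<beta>, l) \<inter> conic_points (\<alpha>', \<beta>', l') = {}" "l \<noteq> l'" "l \<noteq> 0"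
  shows "disjointness_trace (\<alpha>, \<beta>, l) (\<alpha>', \<beta>', l') = 1"
proof (rule ccontr)
  assume *: "\<not> ?thesis"
  define A where "A = l' * \<alpha> + l * \<alpha>'"
  define B where "B = (l' * \<beta> + l * \<beta>') / (l + l')\<^sup>2"
  have s: "l + l' \<noteq> 0" using assms(2) by (simp add: add_eq_0_char2)
  have "Tr (A * B) = 0"
    using * Tr_cases[of "A * B"] by (simp add: A_def B_def disjointness_trace_def)
  then obtain x y where xy: "(x, y) \<noteq> (0, 0)" "A * x\<^sup>2 + (l + l') * x * y + (l + l')\<^sup>2 * B * y\<^sup>2 = 0"
    using quadratic_isotropic s by blast
  obtain z where z: "z\<^sup>2 = (\<alpha> * x\<^sup>2 + x * y + \<beta> * y\<^sup>2) / l" using square_surj by blast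
  define v :: "'a ^ 3" where "v = vector [x, y, z]"
  have v0: "v \<noteq> 0" using xy(1) by (auto simp: v_def vec3_eq_iff)
  have v1: "conic_form (\<alpha>, \<beta>, l) v = 0"
    using assms(3) by (simp add: conic_form_def v_def z add_self)
  have "l * conic_form (\<alpha>', \<beta>', l') v = l' * conic_form (\<alpha>, \<beta>, l) v
      + (A * x\<^sup>2 + (l + l') * x * y + (l + l')\<^sup>2 * B * y\<^sup>2)"
    using s by (simp add: conic_form_def v_def A_def B_def) (simp add: algebra_simps char_2)
  then have "conic_form (\<alpha>', \<beta>', l') v = 0" using v1 xy(2) assms(3) by simp
  then have "vec.span {v} \<in> conic_points (\<alpha>, \<beta>, l) \<inter> conic_points (\<alpha>', \<beta>', l')"
    using v0 v1 span_mem_conic_points by blast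
  then show False using assms(1) by blast
qed

text \<open>Substituting z = e x + f y, a line off the nucleus, leaves a binary form whose x y
  coefficient is still 1. It therefore never has a double zero, and the trace of the product of the
  other two coefficients decides between two zeros and none.\<close>

lemma card_conic_secant:
  fixes \<alpha> \<beta> l e f :: 'a
  defines "L \<equiv> {v :: 'a ^ 3. v $ 3 = e * v $ 1 + f * v $ 2}"
  shows "card {P \<in> conic_points (\<alpha>, \<beta>, l). P \<subseteq> L} = (if Tr ((\<alpha> + l * e\<^sup>2) * (\<beta> + l * f\<^sup>2)) = 0 then 2 else 0)"
proof -
  define A where "A = \<alpha> + l * e\<^sup>2"
  define B where "B = \<beta> + l * f\<^sup>2"
  define S where "S = {P \<in> conic_points (\<alpha>, \<beta>, l). P \<subseteq> L}"
  define w :: "'a \<Rightarrow> 'a \<Rightarrow> 'a ^ 3" where "w x y = vector [x, y, e * x + f * y]" for x y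
  have w: "w x y $ 1 = x" "w x y $ 2 = y" "w x y $ 3 = e * x + f * y" for x y by (simp_all add: w_def)
  have L: "vec.subspace L" by (auto simp: L_def vec.subspace_def algebra_simps)
  have form: "conic_form (\<alpha>, \<beta>, l) (w x y) = A * x\<^sup>2 + x * y + B * y\<^sup>2" for x y
    by (simp add: conic_form_def w A_def B_def square_add power_mult_distrib algebra_simps)
  have S1: "vec.span {w x y} \<in> S" if "A * x\<^sup>2 + x * y + B * y\<^sup>2 = 0" "x \<noteq> 0 \<or> y \<noteq> 0" for x y
  proof -
    have "w x y \<noteq> 0" using that(2) by (auto simp: vec3_eq_iff w)
    then show ?thesis using that(1)
      by (simp add: S_def span_mem_conic_points form span_subset_iff[OF L]) (simp add: L_def w)
  qed
  have S2: "\<exists>x y. P = vec.span {w x y} \<and> A * x\<^sup>2 + x * y + B * y\<^sup>2 = 0 \<and> (x \<noteq> 0 \<or> y \<noteq> 0)" if "P \<in> S" for P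
  proof -
    obtain v where v: "v \<noteq> 0" "P = vec.span {v}" "conic_form (\<alpha>, \<beta>, l) v = 0" "v \<in> L"
      using \<open>P \<in> S\<close> by (auto simp: S_def conic_points_eq span_subset_iff[OF L])
    then have "v = w (v $ 1) (v $ 2)" by (simp add: vec3_eq_iff w L_def)
    moreover from this have "v $ 1 \<noteq> 0 \<or> v $ 2 \<noteq> 0" using v(1) by (auto simp: vec3_eq_iff w)
    ultimately show ?thesis using v form by metis
  qed
  have scale: "vec.span {w x y} = vec.span {w (x / y) 1}" if "y \<noteq> 0" for x y
  proof -
    have "w x y = y *s w (x / y) 1" using that by (simp add: vec3_eq_iff w field_simps)
    then show ?thesis using span_singleton_scale that by metis
  qed
  have inj: "vec.span {w x 1} \<noteq> vec.span {w y 1}" if "x \<noteq> y" for x y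
  proof
    assume "vec.span {w x 1} = vec.span {w y 1}"
    moreover have "w x 1 \<noteq> 0" by (simp add: vec3_eq_iff w)
    ultimately obtain k where "w x 1 = k *s w y 1" using span_singleton_eqD by blast
    then show False using that by (simp add: vec3_eq_iff w)
  qed
  \<comment> \<open>A = 0 is set apart: the form is then y (x + B y), while for nonzero A the
    quantity A x / y solves an Artin-Schreier equation.\<close>
  consider "Tr (A * B) = 1" | "Tr (A * B) = 0" "A = 0" | "Tr (A * B) = 0" "A \<noteq> 0"
    using Tr_cases by blast
  then have "card S = (if Tr (A * B) = 0 then 2 else 0)"
  proof cases
    case 1
    have "S = {}"
    proof (rule ccontr)
      assume "S \<noteq> {}"
      then obtain P where "P \<in> S" by blast
      from S2[OF this] obtain x y where "A * x\<^sup>2 + x * y + B * y\<^sup>2 = 0" "x \<noteq> 0 \<or> y \<noteq> 0" by blast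
      then show False using quadratic_anisotropic[OF 1, of 1 x y] by simp
    qed
    then show ?thesis using 1 by simp
  next
    case 2
    have "S = {vec.span {w 1 0}, vec.span {w B 1}}"
    proof (intro equalityI subsetI)
      fix P assume "P \<in> S"
      then obtain x y where P: "P = vec.span {w x y}" "x * y + B * y\<^sup>2 = 0" "x \<noteq> 0 \<or> y \<noteq> 0"
        using S2 2 by fastforce
      show "P \<in> {vec.span {w 1 0}, vec.span {w B 1}}"
      proof (cases "y = 0")
        case True
        then have "w x y = x *s w 1 0" by (simp add: vec3_eq_iff w)
        then show ?thesis using True P span_singleton_scale by auto
      next
        case False
        have "y * (x + B * y) = 0" using P(2) by (simp add: algebra_simps power2_eq_square)
        then have "x = B * y" using False by (simp add: add_eq_0_char2)
        then show ?thesis using scale[OF False, of x] P False by simp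
      qed
    next
      fix P assume "P \<in> {vec.span {w 1 0}, vec.span {w B 1}}"
      moreover have "vec.span {w 1 0} \<in> S" "vec.span {w B 1} \<in> S"
        using S1[of 1 0] S1[of B 1] 2 by (simp_all add: add_self)
      ultimately show "P \<in> S" by blast
    qed
    moreover have "vec.span {w 1 0} \<noteq> vec.span {w B 1}"
    proof
      assume "vec.span {w 1 0} = vec.span {w B 1}"
      moreover have "w 1 0 \<noteq> 0" by (simp add: vec3_eq_iff w)
      ultimately obtain k where "w 1 0 = k *s w B 1" using span_singleton_eqD by blast
      then show False by (auto simp add: vec3_eq_iff w)
    qed
    ultimately show ?thesis using 2 by simp
  next
    case 3
    obtain t where t: "A * B = t\<^sup>2 + t" using 3 Tr_eq_0_iff by blast
    have root: "A * x\<^sup>2 + x + B = 0 \<longleftrightarrow> x = t / A \<or> x = (t + 1) / A" for x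
    proof -
      have "A * x\<^sup>2 + x + B = 0 \<longleftrightarrow> A * (A * x\<^sup>2 + x + B) = 0" using 3 by simp
      also have "A * (A * x\<^sup>2 + x + B) = ((A * x)\<^sup>2 + A * x) + A * B"
        by (simp add: algebra_simps power2_eq_square)
      also note t
      also have "((A * x)\<^sup>2 + A * x) + (t\<^sup>2 + t) = 0 \<longleftrightarrow> A * x = t \<or> A * x = t + 1"
        by (simp only: add_eq_0_char2 artin_schreier_eq_iff)
      also have "\<dots> \<longleftrightarrow> x = t / A \<or> x = (t + 1) / A" using 3 by (auto simp: field_simps)
      finally show ?thesis .
    qed
    have "S = {vec.span {w (t / A) 1}, vec.span {w ((t + 1) / A) 1}}"
    proof (intro equalityI subsetI)
      fix P assume "P \<in> S"
      then obtain x y where P: "P = vec.span {w x y}" "A * x\<^sup>2 + x * y + B * y\<^sup>2 = 0" "x \<noteq> 0 \<or> y \<noteq> 0"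
        using S2 by fastforce
      then have y: "y \<noteq> 0" using 3 by auto
      have "A * (x / y)\<^sup>2 + x / y + B = (A * x\<^sup>2 + x * y + B * y\<^sup>2) / y\<^sup>2"
        using y by (simp add: field_simps power2_eq_square)
      then have "x / y = t / A \<or> x / y = (t + 1) / A" using P(2) by (simp flip: root)
      then show "P \<in> {vec.span {w (t / A) 1}, vec.span {w ((t + 1) / A) 1}}"
        unfolding P(1) scale[OF y] by (elim disjE) (simp_all only: insert_iff simp_thms)
    next
      fix P assume "P \<in> {vec.span {w (t / A) 1}, vec.span {w ((t + 1) / A) 1}}"
      moreover have "vec.span {w (t / A) 1} \<in> S" "vec.span {w ((t + 1) / A) 1} \<in> S"
        using S1[of _ 1] root by simp_all
      ultimately show "P \<in> S" by blast
    qed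
    moreover have "t / A \<noteq> (t + 1) / A" using 3 by (simp add: field_simps)
    ultimately show ?thesis using 3 inj by simp
  qed
  then show ?thesis by (simp add: S_def A_def B_def)
qed

text \<open>Translation by an element of value 1 exchanges the two values of h. For a subgroup of
  order 8 the count is thus 0 or 4, the source of the two possible intersection numbers of a line
  off the nucleus.\<close>

lemma card_additive_eq_1:
  fixes h :: "'a \<Rightarrow> 'a"
  assumes "additive_subgroup A" and add: "\<And>x y. x \<in> A \<Longrightarrow> y \<in> A \<Longrightarrow> h (x + y) = h x + h y"
    and val: "\<And>x. x \<in> A \<Longrightarrow> h x = 0 \<or> h x = 1"
  shows "card {x \<in> A. h x = 1} = 0 \<or> 2 * card {x \<in> A. h x = 1} = card A"
proof (cases "\<exists>u\<in>A. h u = 1")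
  case True
  then obtain u where u: "u \<in> A" "h u = 1" by blast
  have A: "x + u \<in> A" if "x \<in> A" for x using that u assms(1) by (auto simp: additive_subgroup_iff)
  have "bij_betw (\<lambda>x. x + u) {x \<in> A. h x = 0} {x \<in> A. h x = 1}"
    by (rule bij_betwI[where g = "\<lambda>x. x + u"]) (auto simp: A add u char_2 add.assoc)
  then have "card {x \<in> A. h x = 0} = card {x \<in> A. h x = 1}" by (rule bij_betw_same_card)
  moreover have "A = {x \<in> A. h x = 0} \<union> {x \<in> A. h x = 1}" using val by blast
  then have "card A = card {x \<in> A. h x = 0} + card {x \<in> A. h x = 1}"
    by (subst card_Un_disjoint[symmetric]) auto
  ultimately show ?thesis by simp
qed auto

text \<open>In characteristic 2 the mixed terms of the cube are x^2 y + x y^2. On an isotropic set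
  closed under addition Tr(x^3) is therefore additive.\<close>

lemma Tr_cube_add: "Tr ((x + y) ^ 3) = Tr (x ^ 3) + Tr (y ^ 3) + Tr (x * y * (x + y))"
proof -
  have "(x + y) ^ 3 = x ^ 3 + y ^ 3 + x * y * (x + y)"
    by (simp add: power3_eq_cube algebra_simps char_2)
  then show ?thesis by (simp add: Tr_add)
qed

lemma disjointness_trace_mathon_conics:
  assumes "x \<noteq> y"
  shows "disjointness_trace (1, d + x ^ 3, x) (1, d + y ^ 3, y) = Tr (d + x * y * (x + y))"
proof -
  have s: "x + y \<noteq> 0" using assms by (simp add: add_eq_0_char2)
  have "(y * 1 + x * 1) * (y * (d + x ^ 3) + x * (d + y ^ 3)) = (d + x * y * (x + y)) * (x + y)\<^sup>2"
    by (simp add: power3_eq_cube power2_eq_square algebra_simps char_2)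
  then show ?thesis using s by (simp add: disjointness_trace_def)
qed

text \<open>Contains no trace condition, so it also applies to \<open>mathon_conics\<close>, and
  still suffices to count points on the lines through the nucleus.\<close>

definition disjoint_conics :: "('a \<times> 'a \<times> 'a) set \<Rightarrow> bool" where
  "disjoint_conics C \<longleftrightarrow> (\<forall>(\<alpha>, \<beta>, l)\<in>C. l \<noteq> 0) \<and> disjoint_family_on conic_points C"

lemma disjoint_conics_familyI:
  assumes "\<And>x y. x \<in> A - {0} \<Longrightarrow> y \<in> A - {0} \<Longrightarrow> x \<noteq> y \<Longrightarrow>
      disjointness_trace (p x, r x, x) (p y, r y, y) = 1"
  shows "disjoint_conics (conic_family p r A)"
proof -
  have "conic_points (p x, r x, x) \<inter> conic_points (p y, r y, y) = {}"
    if "x \<in> A - {0}" "y \<in> A - {0}" "(p x, r x, x) \<noteq> (p y, r y, y)" for x y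
    using that by (intro conic_points_disjointI assms) auto
  then show ?thesis
    unfolding disjoint_conics_def disjoint_family_on_def conic_family_def by blast
qed

lemma card_conic_family [simp]: "card (conic_family p r A) = card (A - {0 :: 'a})"
  unfolding conic_family_def by (rule card_image) (auto intro: inj_onI)

text \<open>In characteristic 2 all lines through the nucleus are tangents: on the points (n, m, z)
  a conic equation prescribes z^2, and squaring is bijective. Each conic contributes one point, and
  disjointness keeps these points apart.\<close>

lemma card_line_through_nucleus:
  fixes m n :: 'a
  assumes C: "disjoint_conics C" and mn: "m \<noteq> 0 \<or> n \<noteq> 0"
  defines "L \<equiv> {v :: 'a ^ 3. m * v $ 1 = n * v $ 2}"
  shows "card {P \<in> conic_arc C. P \<subseteq> L} = card C + 1"
proof -
  have Ls: "vec.subspace L"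
    unfolding L_def vec.subspace_def by (simp add: algebra_simps)
  define z :: "'a \<times> 'a \<times> 'a \<Rightarrow> 'a" where
    "z = (\<lambda>(\<alpha>, \<beta>, l). SOME z. z\<^sup>2 = (\<alpha> * n\<^sup>2 + n * m + \<beta> * m\<^sup>2) / l)"
  have z: "(z (\<alpha>, \<beta>, l))\<^sup>2 = (\<alpha> * n\<^sup>2 + n * m + \<beta> * m\<^sup>2) / l" for \<alpha> \<beta> l
    unfolding z_def prod.case by (rule someI_ex) (rule square_surj)
  define w :: "'a \<times> 'a \<times> 'a \<Rightarrow> 'a ^ 3" where "w c = vector [n, m, z c]" for c
  have w: "w c $ 1 = n" "w c $ 2 = m" "w c $ 3 = z c" for c by (simp_all add: w_def)
  have w0: "w c \<noteq> 0" for c using mn by (auto simp: vec3_eq_iff w)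
  have wc: "vec.span {w c} \<in> conic_points c" if "c \<in> C" for c
  proof -
    obtain \<alpha> \<beta> l where c: "c = (\<alpha>, \<beta>, l)" by (cases c)
    then have "l \<noteq> 0" using that C by (auto simp: disjoint_conics_def)
    then show ?thesis unfolding c
      by (simp add: span_mem_conic_points w0 conic_form_def w z add_self)
  qed
  have "{P \<in> conic_arc C. P \<subseteq> L} = insert nucleus ((\<lambda>c. vec.span {w c}) ` C)"
  proof (intro equalityI subsetI)
    fix P assume "P \<in> {P \<in> conic_arc C. P \<subseteq> L}"
    then have "P \<in> conic_arc C" "P \<subseteq> L" by simp_all
    then obtain v where v: "v \<noteq> 0" "P = vec.span {v}" by (elim conic_arcE)
    have "v \<in> L" using v \<open>P \<subseteq> L\<close> span_subset_iff[OF Ls] by blast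
    then have eq: "m * v $ 1 = n * v $ 2" by (simp add: L_def)
    obtain k where k: "v $ 1 = k * n" "v $ 2 = k * m"
    proof (cases "m = 0")
      case True
      then show thesis using that[of "v $ 1 / n"] eq mn by auto
    next
      case False
      then show thesis using that[of "v $ 2 / m"] eq by (auto simp: field_simps)
    qed
    show "P \<in> insert nucleus ((\<lambda>c. vec.span {w c}) ` C)"
    proof (cases "P = nucleus")
      case False
      then have "k \<noteq> 0" using k v span_eq_nucleus by force
      obtain \<alpha> \<beta> l where l: "(\<alpha>, \<beta>, l) \<in> C" "P \<in> conic_points (\<alpha>, \<beta>, l)"
        using \<open>P \<in> conic_arc C\<close> False by (auto simp: conic_arc_def)
      then have "l \<noteq> 0" using C by (auto simp: disjoint_conics_def)
      have "conic_form (\<alpha>, \<beta>, l) v = 0" using l v span_mem_conic_points by blast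
      then have "l * (v $ 3)\<^sup>2 = k\<^sup>2 * (\<alpha> * n\<^sup>2 + n * m + \<beta> * m\<^sup>2)"
        by (simp add: conic_form_def k add_eq_0_char2 power_mult_distrib)
           (simp add: algebra_simps power2_eq_square)
      then have "(v $ 3)\<^sup>2 = k\<^sup>2 * (z (\<alpha>, \<beta>, l))\<^sup>2" using \<open>l \<noteq> 0\<close> by (simp add: z field_simps)
      then have "v $ 3 = k * z (\<alpha>, \<beta>, l)" by (metis power_mult_distrib square_inj)
      then have "v = k *s w (\<alpha>, \<beta>, l)" by (simp add: vec3_eq_iff w k)
      then show ?thesis using l(1) v(2) \<open>k \<noteq> 0\<close> span_singleton_scale by blast
    qed simp
  next
    fix P assume "P \<in> insert nucleus ((\<lambda>c. vec.span {w c}) ` C)"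
    then consider "P = nucleus" | c where "c \<in> C" "P = vec.span {w c}" by blast
    then show "P \<in> {P \<in> conic_arc C. P \<subseteq> L}"
    proof cases
      case 1
      have "vector [0, 0, 1] \<in> L" by (simp add: L_def)
      then show ?thesis using 1 by (simp add: conic_arc_def nucleus_def span_subset_iff[OF Ls])
    next
      case 2
      then have "P \<in> conic_arc C" using wc[of c] by (auto simp: conic_arc_def)
      moreover have "w c \<in> L" by (simp add: L_def w mult.commute)
      ultimately show ?thesis using 2 by (simp add: span_subset_iff[OF Ls])
    qed
  qed
  moreover have "inj_on (\<lambda>c. vec.span {w c}) C"
  proof (rule inj_onI, rule ccontr)
    fix x y assume *: "x \<in> C" "y \<in> C" "vec.span {w x} = vec.span {w y}" "x \<noteq> y"
    then have "conic_points x \<inter> conic_points y = {}"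
      using C unfolding disjoint_conics_def disjoint_family_on_def by blast
    then show False using * wc[of x] wc[of y] by auto
  qed
  moreover have "vec.span {w c} \<noteq> nucleus" for c
    using mn by (auto simp: span_eq_nucleus[OF w0] w)
  then have "nucleus \<notin> (\<lambda>c. vec.span {w c}) ` C" by blast
  ultimately show ?thesis by (simp add: card_image)
qed

text \<open>A line through the nucleus meets the arc in a nonzero number of points, which must then
  be d.\<close>

lemma card_conics_of_maximal_arc:
  fixes M :: "'a ^ 3 ^ 3"
  assumes "invertible M" "maximal_arc d (image ((*v) M) ` conic_arc C)" "disjoint_conics C"
  shows "card C + 1 = d"
proof -
  have inj: "inj ((*v) M)"
    using assms(1) by (metis invertible_def matrix_left_invertible_injective)
  define L where "L = {v :: 'a ^ 3. v $ 2 = 0}"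
  have "{P \<in> image ((*v) M) ` conic_arc C. P \<subseteq> ((*v) M) ` L} = image ((*v) M) ` {P \<in> conic_arc C. P \<subseteq> L}"
  proof -
    have "{P \<in> F ` S. P \<subseteq> T} = F ` {P \<in> S. F P \<subseteq> T}" for F :: "('a ^ 3) set \<Rightarrow> ('a ^ 3) set" and S T
      by blast
    then show ?thesis by (simp only: inj_image_subset_iff[OF inj])
  qed
  moreover have "inj (image ((*v) M))" by (simp add: inj_def inj_image_eq_iff[OF inj])
  ultimately have "card {P \<in> image ((*v) M) ` conic_arc C. P \<subseteq> ((*v) M) ` L} = card {P \<in> conic_arc C. P \<subseteq> L}"
    by (simp add: card_image inj_on_subset)
  also have "\<dots> = card C + 1"
  proof -
    have "L = {v. 0 * v $ 1 = 1 * v $ 2}" by (auto simp: L_def)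
    then show ?thesis using card_line_through_nucleus[OF assms(3), of 0 1] by simp
  qed
  finally have card: "card {P \<in> image ((*v) M) ` conic_arc C. P \<subseteq> ((*v) M) ` L} = card C + 1" .
  have "((*v) M) ` L \<in> pg_lines"
    unfolding L_def by (rule image_pg_lines[OF assms(1) nucleus_line])
  with assms(2) have "card {P \<in> image ((*v) M) ` conic_arc C. P \<subseteq> ((*v) M) ` L} = 0 \<or>
      card {P \<in> image ((*v) M) ` conic_arc C. P \<subseteq> ((*v) M) ` L} = d"
    unfolding maximal_arc_def by blast
  then show ?thesis unfolding card by simp
qed

lemma disjoint_mathon_conics:
  assumes "isotropic A"
  shows "disjoint_conics (mathon_conics A)"
  unfolding mathon_conics_def using assms
  by (intro disjoint_conics_familyI) (auto simp: disjointness_trace_mathon_conics Tr_add isotropic_def)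

text \<open>Lines through the nucleus carry 1 + 7 points. Any other line meets each conic in 0 or 2
  points, and the conics met twice are those where an additive function on A is 1, hence none or
  four of them.\<close>

lemma maximal_arc_mathon_conics:
  assumes "isotropic A"
  shows "maximal_arc 8 (conic_arc (mathon_conics A))"
proof -
  have sub: "additive_subgroup A" and card_A: "card A = 8"
    using assms by (auto simp: isotropic_def)
  have iso: "Tr (x * y * (x + y)) = 0" if "x \<in> A" "y \<in> A" for x y
    using assms that by (auto simp: isotropic_def)
  define K where "K = conic_arc (mathon_conics A)"
  have card_A0: "card (A - {0}) = 7"
    using assms by (simp add: isotropic_def additive_subgroup_def)
  have disj: "conic_points (1, 1 + x ^ 3, x) \<inter> conic_points (1, 1 + y ^ 3, y) = {}"
    if "x \<in> A - {0}" "y \<in> A - {0}" "x \<noteq> y" for x y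
    using that by (intro conic_points_disjointI) (auto simp: disjointness_trace_mathon_conics Tr_add iso)
  have "card {P \<in> K. P \<subseteq> L} = 0 \<or> card {P \<in> K. P \<subseteq> L} = 8" if L: "L \<in> pg_lines" for L
  proof -
    have Ls: "vec.subspace L" using L by (simp add: pg_lines_def)
    obtain n :: "'a ^ 3" where n: "n \<noteq> 0" "L = {v. n $ 1 * v $ 1 + n $ 2 * v $ 2 + n $ 3 * v $ 3 = 0}"
      by (rule pg_lines_hyperplane[OF L])
    show ?thesis
    proof (cases "n $ 3 = 0")
      case True
      have "n $ 1 \<noteq> 0 \<or> n $ 2 \<noteq> 0" using n(1) True by (auto simp: vec3_eq_iff)
      then show ?thesis
        using card_line_through_nucleus[OF disjoint_mathon_conics[OF assms], of "n $ 1" "n $ 2"] n(2) True card_A0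
        by (simp add: K_def mathon_conics_def add_eq_0_char2)
    next
      case False
      define e where "e = n $ 1 / n $ 3"
      define f where "f = n $ 2 / n $ 3"
      have L_eq: "L = {v. v $ 3 = e * v $ 1 + f * v $ 2}"
      proof -
        have "n $ 1 * v $ 1 + n $ 2 * v $ 2 + n $ 3 * v $ 3 = n $ 3 * (e * v $ 1 + f * v $ 2 + v $ 3)" for v :: "'a ^ 3"
          using False by (simp add: e_def f_def field_simps)
        then show ?thesis using False by (auto simp: n(2) add_eq_0_char2)
      qed
      \<comment> \<open>The terms other than l^3 have exponents 1, 2, 4 in l and are additive; the
        failure of l^3 to be additive under the trace is the form that vanishes on A.\<close>
      define h where "h l = Tr (l ^ 3 + l * f\<^sup>2 + l * e\<^sup>2 + l ^ 4 * e\<^sup>2 + l\<^sup>2 * e\<^sup>2 * f\<^sup>2)" for l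
      have h: "Tr ((1 + l * e\<^sup>2) * (1 + l ^ 3 + l * f\<^sup>2)) = 1 + h l" for l
      proof -
        have "(1 + l * e\<^sup>2) * (1 + l ^ 3 + l * f\<^sup>2) = 1 + (l ^ 3 + l * f\<^sup>2 + l * e\<^sup>2 + l ^ 4 * e\<^sup>2 + l\<^sup>2 * e\<^sup>2 * f\<^sup>2)"
          by (simp add: power2_eq_square power3_eq_cube power4_eq_xxxx algebra_simps)
        then show ?thesis by (simp add: h_def Tr_add)
      qed
      have h_add: "h (x + y) = h x + h y" if "x \<in> A" "y \<in> A" for x y
        using iso[OF that] frob_add[of x y 2]
        by (simp add: h_def Tr_add Tr_cube_add square_add distrib_right add_ac)
      have h01: "h l = 0 \<or> h l = 1" for l unfolding h_def by (rule Tr_cases)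
      define S where "S l = {P \<in> conic_points (1, 1 + l ^ 3, l). P \<subseteq> L}" for l
      have "vector [0, 0, 1] \<notin> L" by (simp add: L_eq)
      then have "\<not> nucleus \<subseteq> L" by (simp add: nucleus_def span_subset_iff[OF Ls])
      then have "{P \<in> K. P \<subseteq> L} = (\<Union>l\<in>A - {0}. S l)"
        by (auto simp: K_def conic_arc_def mathon_conics_def conic_family_def S_def)
      moreover have "S x \<inter> S y = {}" if "x \<in> A - {0}" "y \<in> A - {0}" "x \<noteq> y" for x y
        using disj[OF that] by (auto simp: S_def)
      then have "card (\<Union>l\<in>A - {0}. S l) = (\<Sum>l\<in>A - {0}. card (S l))"
        by (intro card_UN_disjoint) auto
      ultimately have "card {P \<in> K. P \<subseteq> L} = (\<Sum>l\<in>A - {0}. card (S l))" by simp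
      also have "\<dots> = (\<Sum>l\<in>A - {0}. if h l = 1 then 2 else 0)"
      proof (rule sum.cong)
        fix l
        show "card (S l) = (if h l = 1 then 2 else 0)"
          unfolding S_def L_eq card_conic_secant h using h01[of l] by (auto simp: add_self)
      qed simp
      also have "\<dots> = 2 * card {l \<in> A - {0}. h l = 1}"
        by (simp add: sum.If_cases Int_def)
      also have "{l \<in> A - {0}. h l = 1} = {l \<in> A. h l = 1}"
        by (auto simp: h_def)
      finally show ?thesis
        using card_additive_eq_1[of A h, OF sub h_add h01] card_A by auto
    qed
  qed
  moreover have "K \<subseteq> pg_points"
    using span_mem_pg_points by (auto simp: K_def elim: conic_arcE)
  moreover have "vec.span {vector [1, 0, 0] :: 'a ^ 3} \<in> pg_points - K"
  proof -
    have "vector [1, 0, 0] \<noteq> (0 :: 'a ^ 3)" by (simp add: vec3_eq_iff)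
    then show ?thesis
      by (auto simp: span_mem_pg_points K_def span_mem_conic_arc mathon_conics_def conic_family_def conic_form_def)
  qed
  moreover have "K \<noteq> {}" by (simp add: K_def conic_arc_def)
  ultimately show ?thesis unfolding maximal_arc_def K_def by blast
qed

section \<open>The normal forms are proper Mathon arcs\<close>

lemma card_isotropic: "isotropic A \<Longrightarrow> card (A - {0}) = 7"
  by (simp add: isotropic_def additive_subgroup_def)

lemma isotropic_nonempty: "isotropic A \<Longrightarrow> A - {0} \<noteq> {}"
  by (metis card_isotropic card.empty zero_neq_numeral)

lemma card_mathon_conics: "isotropic A \<Longrightarrow> card (mathon_conics A) = 7"
  by (simp add: mathon_conics_def card_isotropic)

text \<open>The line \<open>z = \<surd>b y\<close> misses the arc; moving it to \<open>z = 0\<close> gives a closed set of conics.\<close>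

lemma ex_external_line:
  assumes "isotropic A"
  shows "\<exists>b. \<forall>l\<in>A. Tr (l ^ 3 + l * b) = 0"
proof (rule ccontr)
  assume *: "\<not> ?thesis"
  have sub: "additive_subgroup A" and card_A: "card A = 8" using assms by (auto simp: isotropic_def)
  have four: "card {l \<in> A. Tr (l ^ 3 + l * b) = 1} = 4" for b
  proof -
    have "Tr ((x + y) ^ 3 + (x + y) * b) = Tr (x ^ 3 + x * b) + Tr (y ^ 3 + y * b)" if "x \<in> A" "y \<in> A" for x y
      using that assms by (simp add: Tr_cube_add Tr_add distrib_right isotropic_def add_ac)
    then have "card {l \<in> A. Tr (l ^ 3 + l * b) = 1} = 0 \<or> 2 * card {l \<in> A. Tr (l ^ 3 + l * b) = 1} = card A"
      by (intro card_additive_eq_1 sub Tr_cases)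
    moreover have "{l \<in> A. Tr (l ^ 3 + l * b) = 1} \<noteq> {}" using * Tr_cases by blast
    then have "card {l \<in> A. Tr (l ^ 3 + l * b) = 1} \<noteq> 0" by (metis card_0_eq finite)
    ultimately show ?thesis unfolding card_A by linarith
  qed
  have sixteen: "card {b. Tr (l ^ 3 + l * b) = 1} = 16" if "l \<noteq> 0" for l
  proof -
    have "bij_betw (\<lambda>b. l ^ 3 + l * b) {b. Tr (l ^ 3 + l * b) = 1} {x. Tr x = 1}"
      by (rule bij_betwI[where g = "\<lambda>x. (x + l ^ 3) / l"]) (use that in \<open>auto simp: field_simps char_2\<close>)
    then show ?thesis using card_Tr_eq_1 bij_betw_same_card by metis
  qed
  \<comment> \<open>Double count of the pairs (b, l) with trace 1: if no b were good, the 32 values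
    of b would give 32 * 4 = 128 pairs, but the seven nonzero l give 7 * 16 = 112.\<close>
  have "(\<Sum>b\<in>(UNIV :: 'a set). card {l \<in> A. Tr (l ^ 3 + l * b) = 1})
      = (\<Sum>b\<in>(UNIV :: 'a set). \<Sum>l\<in>A. if Tr (l ^ 3 + l * b) = 1 then 1 else 0)"
    by (simp add: sum.If_cases Int_def)
  also have "\<dots> = (\<Sum>l\<in>A. \<Sum>b\<in>(UNIV :: 'a set). if Tr (l ^ 3 + l * b) = 1 then 1 else 0)"
    by (rule sum.swap)
  also have "\<dots> = (\<Sum>l\<in>A. card {b. Tr (l ^ 3 + l * b) = 1})"
    by (simp add: sum.If_cases)
  also have "\<dots> = (\<Sum>l\<in>A - {0}. card {b. Tr (l ^ 3 + l * b) = 1})"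
    by (rule sum.mono_neutral_right) auto
  also have "\<dots> = 7 * 16" using sixteen card_isotropic[OF assms] by simp
  finally show False by (simp add: four card_field)
qed

text \<open>Adding l b to \<beta> corresponds to replacing z by z + f y with f^2 = b, and the choice
  of b restores the trace condition.\<close>

lemma mathon_type_mathon_conics:
  assumes "isotropic A"
  shows "mathon_type (conic_arc (mathon_conics A))"
proof -
  have sub: "additive_subgroup A" using assms by (simp add: isotropic_def)
  obtain b where b: "\<And>l. l \<in> A \<Longrightarrow> Tr (l ^ 3 + l * b) = 0" using ex_external_line[OF assms] by blast
  obtain f where f: "f\<^sup>2 = b" using square_surj by blast
  define C where "C = conic_family (\<lambda>_. 1) (\<lambda>l. 1 + l ^ 3 + l * b) A"
  define h :: "'a \<times> 'a \<times> 'a \<Rightarrow> 'a \<times> 'a \<times> 'a" where "h = (\<lambda>(\<alpha>, \<beta>, l). (1, 1 + l ^ 3, l))"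
  obtain M where M: "invertible M" "image ((*v) M) ` conic_arc C = conic_arc (h ` C)"
    by (rule conic_arc_transform[of 1 1 0 0 1 C h 0 f])
       (auto simp: C_def conic_family_def h_def f algebra_simps)
  have "h ` C = mathon_conics A"
    by (simp add: C_def h_def conic_family_def mathon_conics_def image_image)
  have "conic_comp c c' \<in> C" if c: "c \<in> C" "c' \<in> C" "c \<noteq> c'" for c c'
  proof -
    obtain l l' where l: "l \<in> A" "l' \<in> A" "c = (1, 1 + l ^ 3 + l * b, l)" "c' = (1, 1 + l' ^ 3 + l' * b, l')"
      using c(1,2) by (auto simp: C_def conic_family_def)
    then have "l \<noteq> l'" using c(3) by blast
    then have s: "l + l' \<noteq> 0" by (simp add: add_eq_0_char2)
    \<comment> \<open>Closedness is additivity of l \<beta>, here of l + l^4 + b l^2.\<close>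
    have "(1 + l ^ 3 + l * b) * l + (1 + l' ^ 3 + l' * b) * l' = (1 + (l + l') ^ 3 + (l + l') * b) * (l + l')"
      by (simp add: power3_eq_cube algebra_simps char_2)
    then have "conic_comp c c' = (1, 1 + (l + l') ^ 3 + (l + l') * b, l + l')"
      using s by (simp add: l)
    moreover have "l + l' \<in> A - {0}" using l s sub by (simp add: additive_subgroup_iff)
    ultimately show ?thesis by (simp add: C_def conic_family_def)
  qed
  moreover have "inj_on (\<lambda>(\<alpha>, \<beta>, l). l) C" by (auto simp: C_def conic_family_def inj_on_def)
  moreover have "\<forall>(\<alpha>, \<beta>, l)\<in>C. abs_trace (\<alpha> * \<beta>) = 1 \<and> l \<noteq> 0"
    using b by (auto simp: C_def conic_family_def abs_trace_eq Tr_add add.assoc)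
  ultimately have "closed_conics C" unfolding closed_conics_def by blast
  moreover have "C \<noteq> {}" using isotropic_nonempty[OF assms] by (simp add: C_def conic_family_def)
  moreover have "arc_from C (conic_arc (mathon_conics A))"
  proof -
    have "image ((*v) M) \<in> PGL3" using M(1) by (auto simp: PGL3_def)
    then show ?thesis using maximal_arc_mathon_conics[OF assms] M(2) \<open>h ` C = _\<close>
      unfolding arc_from_def conic_arc_def by metis
  qed
  ultimately show ?thesis unfolding mathon_type_def by blast
qed

text \<open>On the Denniston side \<alpha> and \<beta> are constant, so in the equations of
  \<open>conic_arc_rigidity\<close> the \<lambda>^3 terms, proportional to c^2 and d^2, must vanish
  for seven values of \<lambda>. Then c = d = 0, against D being nonzero.\<close>

lemma not_denniston_type_mathon_conics:
  assumes "isotropic A"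
  shows "\<not> denniston_type (conic_arc (mathon_conics A))"
proof
  assume "denniston_type (conic_arc (mathon_conics A))"
  then obtain \<alpha> A' where A': "Tr \<alpha> = 1"
    and arc: "arc_from {(\<alpha>, 1, l) | l. l \<in> A' - {0}} (conic_arc (mathon_conics A))"
    unfolding denniston_type_def abs_trace_eq by blast
  define C where "C = conic_family (\<lambda>_. \<alpha>) (\<lambda>_. 1) A'"
  have "{(\<alpha>, 1, l) | l. l \<in> A' - {0}} = C" by (auto simp: C_def conic_family_def)
  with arc have "arc_from C (conic_arc (mathon_conics A))" by simp
  then have "\<exists>\<phi>\<in>PGL3. conic_arc (mathon_conics A) = \<phi> ` conic_arc C"
    unfolding arc_from_def conic_arc_def by (rule conjunct2)
  then obtain M :: "'a ^ 3 ^ 3" where M: "invertible M" "image ((*v) M) ` conic_arc C = conic_arc (mathon_conics A)"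
    unfolding PGL3_def by auto
  have "disjoint_conics C"
    unfolding C_def
  proof (rule disjoint_conics_familyI)
    fix x y assume "x \<in> A' - {0}" "y \<in> A' - {0}" "x \<noteq> y"
    then have s: "x + y \<noteq> 0" by (simp add: add_eq_0_char2)
    have "(y * \<alpha> + x * \<alpha>) * (y * 1 + x * 1) = \<alpha> * (x + y)\<^sup>2"
      by (simp add: algebra_simps power2_eq_square)
    then show "disjointness_trace (\<alpha>, 1, x) (\<alpha>, 1, y) = 1"
      using A' s by (simp add: disjointness_trace_def)
  qed
  moreover have "maximal_arc 8 (image ((*v) M) ` conic_arc C)"
    unfolding M(2) by (rule maximal_arc_mathon_conics[OF assms])
  ultimately have "card C + 1 = 8" using card_conics_of_maximal_arc[OF M(1)] by blast
  then have card: "card (A' - {0}) = 7" by (simp add: C_def)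
  define a b c d e f r where "a = M $ 1 $ 1" and "b = M $ 1 $ 2" and "c = M $ 2 $ 1" and "d = M $ 2 $ 2"
    and "e = M $ 3 $ 1" and "f = M $ 3 $ 2" and "r = M $ 3 $ 3"
  note entries = a_def b_def c_def d_def e_def f_def r_def
  define D where "D = a * d + b * c"
  have rigid: "r \<noteq> 0 \<and> D \<noteq> 0 \<and> (\<exists>(\<alpha>', \<beta>', l')\<in>mathon_conics A. l' * r\<^sup>2 = D * l \<and>
     \<alpha>' * a\<^sup>2 + a * c + \<beta>' * c\<^sup>2 + l' * e\<^sup>2 = D * \<alpha> \<and> \<alpha>' * b\<^sup>2 + b * d + \<beta>' * d\<^sup>2 + l' * f\<^sup>2 = D * 1)"
    if "l \<in> A' - {0}" for l
  proof -
    have "(\<alpha>, 1, l) \<in> C" using that by (simp add: C_def conic_family_def)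
    moreover have "card (mathon_conics A) \<le> 7" "l \<noteq> 0" using that by (simp_all add: card_mathon_conics[OF assms])
    ultimately show ?thesis
      using conic_arc_rigidity[OF M(1) eq_refl[OF M(2)]] unfolding entries D_def by blast
  qed
  have "A' - {0} \<noteq> {}" using card by (metis card.empty zero_neq_numeral)
  then have rD: "r \<noteq> 0" "D \<noteq> 0" using rigid by blast+
  \<comment> \<open>The factor by which the collineation multiplies \<lambda>.\<close>
  define k where "k = D / r\<^sup>2"
  have eqs: "(a\<^sup>2 + a * c + c\<^sup>2 + D * \<alpha>) + (k * e\<^sup>2) * l + 0 * l\<^sup>2 + (k ^ 3 * c\<^sup>2) * l ^ 3 + 0 * l ^ 4 = 0"
     "(b\<^sup>2 + b * d + d\<^sup>2 + D) + (k * f\<^sup>2) * l + 0 * l\<^sup>2 + (k ^ 3 * d\<^sup>2) * l ^ 3 + 0 * l ^ 4 = 0"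
    if l: "l \<in> A' - {0}" for l
  proof -
    obtain l' where l': "l' * r\<^sup>2 = D * l"
      "1 * a\<^sup>2 + a * c + (1 + l' ^ 3) * c\<^sup>2 + l' * e\<^sup>2 = D * \<alpha>"
      "1 * b\<^sup>2 + b * d + (1 + l' ^ 3) * d\<^sup>2 + l' * f\<^sup>2 = D * 1"
      using rigid[OF l] by (auto simp: mathon_conics_def conic_family_def)
    have "l' = k * l" using l'(1) rD by (simp add: k_def field_simps)
    then have "a\<^sup>2 + a * c + (1 + (k * l) ^ 3) * c\<^sup>2 + (k * l) * e\<^sup>2 + D * \<alpha> = 0"
      "b\<^sup>2 + b * d + (1 + (k * l) ^ 3) * d\<^sup>2 + (k * l) * f\<^sup>2 + D = 0"
      using l'(2,3) by (simp_all add: add_self)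
    then show "(a\<^sup>2 + a * c + c\<^sup>2 + D * \<alpha>) + (k * e\<^sup>2) * l + 0 * l\<^sup>2 + (k ^ 3 * c\<^sup>2) * l ^ 3 + 0 * l ^ 4 = 0"
     "(b\<^sup>2 + b * d + d\<^sup>2 + D) + (k * f\<^sup>2) * l + 0 * l\<^sup>2 + (k ^ 3 * d\<^sup>2) * l ^ 3 + 0 * l ^ 4 = 0"
      by (simp_all add: algebra_simps power_mult_distrib)
  qed
  have "4 < card (A' - {0})" by (simp only: card)
  then have "k ^ 3 * c\<^sup>2 = 0" "k ^ 3 * d\<^sup>2 = 0"
    using quartic_eq_0_on[OF eqs(1)] quartic_eq_0_on[OF eqs(2)] by blast+
  then have "c = 0" "d = 0" using rD by (simp_all add: k_def)
  with rD show False by (simp add: D_def)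
qed

text \<open>Comparing coefficients in \<lambda>: the cubic term of the first equation gives c = 0,
  its constant term a^2 = D = a d, so a = d, and the cubic term of the second k^3 d^2 = D = d^2. So
  k^3 = 1, hence k = 1, and \<lambda> is unchanged.\<close>

lemma mathon_conics_PGL3_rigid:
  assumes A: "isotropic A" and B: "isotropic B" and M: "invertible M"
    and eq: "image ((*v) M) ` conic_arc (mathon_conics A) = conic_arc (mathon_conics B)"
  shows "A = B"
proof -
  define a b c d e f r where "a = M $ 1 $ 1" and "b = M $ 1 $ 2" and "c = M $ 2 $ 1" and "d = M $ 2 $ 2"
    and "e = M $ 3 $ 1" and "f = M $ 3 $ 2" and "r = M $ 3 $ 3"
  note entries = a_def b_def c_def d_def e_def f_def r_def
  define D where "D = a * d + b * c"
  have rigid: "r \<noteq> 0 \<and> D \<noteq> 0 \<and> (\<exists>(\<alpha>', \<beta>', l')\<in>mathon_conics B. l' * r\<^sup>2 = D * l \<and>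
     \<alpha>' * a\<^sup>2 + a * c + \<beta>' * c\<^sup>2 + l' * e\<^sup>2 = D * 1 \<and>
     \<alpha>' * b\<^sup>2 + b * d + \<beta>' * d\<^sup>2 + l' * f\<^sup>2 = D * (1 + l ^ 3))"
    if "l \<in> A - {0}" for l
  proof -
    have "(1, 1 + l ^ 3, l) \<in> mathon_conics A" using that by (simp add: mathon_conics_def conic_family_def)
    moreover have "card (mathon_conics B) \<le> 7" "l \<noteq> 0" using that by (simp_all add: card_mathon_conics[OF B])
    ultimately show ?thesis
      using conic_arc_rigidity[OF M eq_refl[OF eq]] unfolding entries D_def by blast
  qed
  have rD: "r \<noteq> 0" "D \<noteq> 0" using isotropic_nonempty[OF A] rigid by blast+
  define k where "k = D / r\<^sup>2"
  have k: "k \<noteq> 0" using rD by (simp add: k_def)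
  have eqs: "k * l \<in> B - {0}"
     "(a\<^sup>2 + a * c + c\<^sup>2 + D) + (k * e\<^sup>2) * l + 0 * l\<^sup>2 + (k ^ 3 * c\<^sup>2) * l ^ 3 + 0 * l ^ 4 = 0"
     "(b\<^sup>2 + b * d + d\<^sup>2 + D) + (k * f\<^sup>2) * l + 0 * l\<^sup>2 + (k ^ 3 * d\<^sup>2 + D) * l ^ 3 + 0 * l ^ 4 = 0"
    if l: "l \<in> A - {0}" for l
  proof -
    obtain l' where l': "l' \<in> B - {0}" "l' * r\<^sup>2 = D * l"
      "1 * a\<^sup>2 + a * c + (1 + l' ^ 3) * c\<^sup>2 + l' * e\<^sup>2 = D * 1"
      "1 * b\<^sup>2 + b * d + (1 + l' ^ 3) * d\<^sup>2 + l' * f\<^sup>2 = D * (1 + l ^ 3)"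
      using rigid[OF l] by (auto simp: mathon_conics_def conic_family_def)
    have l'_eq: "l' = k * l" using l'(2) rD by (simp add: k_def field_simps)
    then have "a\<^sup>2 + a * c + (1 + (k * l) ^ 3) * c\<^sup>2 + (k * l) * e\<^sup>2 + D = 0"
      "b\<^sup>2 + b * d + (1 + (k * l) ^ 3) * d\<^sup>2 + (k * l) * f\<^sup>2 + D * (1 + l ^ 3) = 0"
      using l'(3,4) by (simp_all add: add_self)
    then show "(a\<^sup>2 + a * c + c\<^sup>2 + D) + (k * e\<^sup>2) * l + 0 * l\<^sup>2 + (k ^ 3 * c\<^sup>2) * l ^ 3 + 0 * l ^ 4 = 0"
     "(b\<^sup>2 + b * d + d\<^sup>2 + D) + (k * f\<^sup>2) * l + 0 * l\<^sup>2 + (k ^ 3 * d\<^sup>2 + D) * l ^ 3 + 0 * l ^ 4 = 0"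
      by (simp_all add: algebra_simps power_mult_distrib)
    show "k * l \<in> B - {0}" using l'(1) l'_eq by simp
  qed
  have card_A: "4 < card (A - {0})" by (simp only: card_isotropic[OF A])
  have "a\<^sup>2 + a * c + c\<^sup>2 + D = 0" "k ^ 3 * c\<^sup>2 = 0" "k ^ 3 * d\<^sup>2 + D = 0"
    using quartic_eq_0_on[OF eqs(2) card_A] quartic_eq_0_on[OF eqs(3) card_A] by blast+
  then have "c = 0" "a\<^sup>2 + D = 0" using k by auto
  then have "a\<^sup>2 = a * d" by (simp add: D_def add_eq_0_char2)
  then have "a = d" using rD by (auto simp: D_def power2_eq_square \<open>c = 0\<close>)
  note \<open>k ^ 3 * d\<^sup>2 + D = 0\<close>
  then have "k ^ 3 * D = D" by (simp add: D_def \<open>c = 0\<close> \<open>a = d\<close> power2_eq_square add_eq_0_char2)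
  then have "k ^ 3 = 1" using rD by simp
  moreover have "coprime (3 :: nat) 31" by (rule coprime_31) auto
  ultimately have "k = 1" using k power_coprime_31_eq_1 by blast
  then have "A - {0} \<subseteq> B - {0}" using eqs(1) by auto
  then have "A - {0} = B - {0}"
    using card_isotropic[OF A] card_isotropic[OF B] by (intro card_subset_eq) auto
  moreover have "0 \<in> A" "0 \<in> B" using A B by (auto simp: isotropic_def additive_subgroup_def)
  ultimately show ?thesis by blast
qed

section \<open>Field automorphisms and isomorphisms of normal forms\<close>

lemma Tr_automorphism: "field_automorphism \<sigma> \<Longrightarrow> Tr (\<sigma> x) = \<sigma> (Tr x)"
  unfolding Tr_def by (simp add: field_automorphism_power[symmetric]) (simp add: field_automorphism_def)

lemma isotropic_automorphism:
  assumes \<sigma>: "field_automorphism \<sigma>" and A: "isotropic A"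
  shows "isotropic (\<sigma> ` A)"
proof -
  have inj: "inj \<sigma>" using \<sigma> by (simp add: field_automorphism_def bij_is_inj)
  have "0 \<in> \<sigma> ` A" using A \<sigma> by (force simp: isotropic_def additive_subgroup_def image_iff)
  moreover have "x + y \<in> \<sigma> ` A" if xy: "x \<in> \<sigma> ` A" "y \<in> \<sigma> ` A" for x y
  proof -
    obtain u v where "x = \<sigma> u" "y = \<sigma> v" "u \<in> A" "v \<in> A" using xy by blast
    moreover from this have "x + y = \<sigma> (u + v)" using \<sigma> by (simp add: field_automorphism_def)
    ultimately show ?thesis using A by (simp add: isotropic_def additive_subgroup_iff)
  qed
  moreover have "Tr (x * y * (x + y)) = 0" if xy: "x \<in> \<sigma> ` A" "y \<in> \<sigma> ` A" for x y
  proof -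
    obtain u v where uv: "x = \<sigma> u" "y = \<sigma> v" "u \<in> A" "v \<in> A" using xy by blast
    then have "x * y * (x + y) = \<sigma> (u * v * (u + v))" using \<sigma> by (simp add: field_automorphism_def)
    then show ?thesis using A uv \<sigma> by (simp add: isotropic_def Tr_automorphism)
  qed
  moreover have "card (\<sigma> ` A) = 8" using A inj by (simp add: isotropic_def card_image inj_on_subset)
  ultimately show ?thesis by (simp add: isotropic_def additive_subgroup_iff)
qed

text \<open>The polynomials 1 and 1 + \<lambda>^3 have coefficients in the prime field, so
  \<open>\<sigma>\<close> changes only the set of \<lambda>.\<close>

lemma image_map_vec_mathon_arc:
  assumes \<sigma>: "field_automorphism (\<sigma> :: 'a \<Rightarrow> 'a)"
  shows "image (map_vec \<sigma>) ` conic_arc (mathon_conics A) = conic_arc (mathon_conics (\<sigma> ` A))"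
proof -
  have hom: "\<sigma> (x + y) = \<sigma> x + \<sigma> y" "\<sigma> (x * y) = \<sigma> x * \<sigma> y" for x y
    using \<sigma> by (auto simp: field_automorphism_def)
  have surj: "surj \<sigma>" using \<sigma> by (simp add: field_automorphism_def bij_is_surj)
  define h where "h = (\<lambda>(\<alpha>, \<beta>, l). (\<sigma> \<alpha>, \<sigma> \<beta>, \<sigma> l))"
  have "image (map_vec \<sigma>) ` conic_arc (mathon_conics A) = conic_arc (h ` mathon_conics A)"
  proof (rule image_conic_arc[OF _ surj])
    show "map_vec \<sigma> (k *s v) = \<sigma> k *s map_vec \<sigma> v" for k and v :: "'a ^ 3"
      by (simp add: map_vec_def vec_eq_iff hom)
    show "surj (map_vec \<sigma> :: 'a ^ 3 \<Rightarrow> _)"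
      by (rule surjI[of _ "map_vec (inv \<sigma>)"]) (simp add: map_vec_def surj_f_inv_f[OF surj])
    show "map_vec \<sigma> v = 0 \<longleftrightarrow> v = 0" for v :: "'a ^ 3"
      by (simp add: map_vec_def vec_eq_iff \<sigma>)
    show "map_vec \<sigma> v $ 1 = 0 \<and> map_vec \<sigma> v $ 2 = 0 \<longleftrightarrow> v $ 1 = 0 \<and> v $ 2 = 0" for v :: "'a ^ 3"
      by (simp add: map_vec_def \<sigma>)
    fix c and v :: "'a ^ 3"
    have "conic_form (h c) (map_vec \<sigma> v) = \<sigma> (conic_form c v)"
      by (cases c) (simp add: h_def conic_form_def map_vec_def hom field_automorphism_power[OF \<sigma>])
    then show "conic_form (h c) (map_vec \<sigma> v) = 0 \<longleftrightarrow> conic_form c v = 0" by (simp add: \<sigma>)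
  qed
  also have "h ` mathon_conics A = (\<lambda>l. (1, 1 + \<sigma> l ^ 3, \<sigma> l)) ` (A - {0})"
    by (simp add: h_def mathon_conics_def conic_family_def image_image hom \<sigma> field_automorphism_power[OF \<sigma>])
  also have "\<dots> = (\<lambda>l. (1, 1 + l ^ 3, l)) ` \<sigma> ` (A - {0})" by (simp add: image_image)
  also have "\<sigma> ` (A - {0}) = \<sigma> ` A - {0}" using \<sigma> by auto
  finally show ?thesis by (simp add: mathon_conics_def conic_family_def)
qed

text \<open>The semilinear part is split off first: it leads to the normal form of the image of A,
  and the remaining linear map cannot change the subgroup any more.\<close>

lemma arc_iso_mathon_conics_iff:
  assumes A: "isotropic A" and B: "isotropic B"
  shows "(conic_arc (mathon_conics A), conic_arc (mathon_conics B)) \<in> arc_iso \<longleftrightarrow>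
    (\<exists>\<sigma>. field_automorphism \<sigma> \<and> B = \<sigma> ` A)"
proof
  assume "(conic_arc (mathon_conics A), conic_arc (mathon_conics B)) \<in> arc_iso"
  then obtain M \<sigma> where M: "invertible M" and \<sigma>: "field_automorphism \<sigma>"
    and eq: "image (\<lambda>v. M *v map_vec \<sigma> v) ` conic_arc (mathon_conics A) = conic_arc (mathon_conics B)"
    unfolding arc_iso_iff by blast
  have "image ((*v) M) ` conic_arc (mathon_conics (\<sigma> ` A)) = conic_arc (mathon_conics B)"
    unfolding eq[symmetric] image_map_vec_mathon_arc[OF \<sigma>, symmetric] by (simp add: image_image)
  then have "\<sigma> ` A = B"
    by (rule mathon_conics_PGL3_rigid[OF isotropic_automorphism[OF \<sigma> A] B M])
  then show "\<exists>\<sigma>. field_automorphism \<sigma> \<and> B = \<sigma> ` A" using \<sigma> by blast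
next
  assume "\<exists>\<sigma>. field_automorphism \<sigma> \<and> B = \<sigma> ` A"
  then obtain \<sigma> where \<sigma>: "field_automorphism \<sigma>" "B = \<sigma> ` A" by blast
  have "invertible (mat 1 :: 'a ^ 3 ^ 3)" by (simp add: invertible_def)
  moreover have "image (\<lambda>v. mat 1 *v map_vec \<sigma> v) ` conic_arc (mathon_conics A) = conic_arc (mathon_conics B)"
    using image_map_vec_mathon_arc[OF \<sigma>(1)] \<sigma>(2) by simp
  ultimately show "(conic_arc (mathon_conics A), conic_arc (mathon_conics B)) \<in> arc_iso"
    unfolding arc_iso_iff using \<sigma>(1) by blast
qed

lemma field_automorphism_frob: "field_automorphism (\<lambda>x :: 'a. x ^ (2 ^ i))"
proof -
  have "inj (\<lambda>x :: 'a. x ^ (2 ^ i))"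
  proof (rule injI)
    fix x y :: 'a assume "x ^ (2 ^ i) = y ^ (2 ^ i)"
    then have "(x + y) ^ (2 ^ i) = 0" by (simp add: frob_add add_self)
    then show "x = y" by (simp add: add_eq_0_char2)
  qed
  then have "bij (\<lambda>x :: 'a. x ^ (2 ^ i))" by (simp add: bij_def finite_UNIV_inj_surj)
  then show ?thesis by (simp add: field_automorphism_def frob_add power_mult_distrib)
qed

text \<open>As 31 is prime, g has order 31, and its powers exhaust the nonzero elements.\<close>

lemma inj_on_power_31:
  assumes "(g :: 'a) \<noteq> 0" "g \<noteq> 1"
  shows "inj_on (\<lambda>k. g ^ k) {..<31}"
proof -
  have False if jk: "j < k" "k < 31" "g ^ j = g ^ k" for j k
  proof -
    have "g ^ j * g ^ (k - j) = g ^ (j + (k - j))" by (rule power_add[symmetric])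
    also have "j + (k - j) = k" using jk by simp
    finally have "g ^ j * g ^ (k - j) = g ^ j * 1" using jk by simp
    then have "g ^ (k - j) = 1" using assms(1) by simp
    moreover have "coprime (k - j) 31" using jk by (intro coprime_31) auto
    ultimately show False using power_coprime_31_eq_1 assms by blast
  qed
  then show ?thesis by (intro inj_onI) (metis lessThan_iff nat_neq_iff)
qed

text \<open>A generator g of the multiplicative group is a root of the polynomial with roots
  g^(2^i). Its image must be one of these roots, and the image of g determines the
  automorphism.\<close>

lemma field_automorphism_eq_frob:
  assumes \<sigma>: "field_automorphism (\<sigma> :: 'a \<Rightarrow> 'a)"
  shows "\<exists>i<5. \<sigma> = (\<lambda>x. x ^ (2 ^ i))"
proof -
  have hom: "\<sigma> (x + y) = \<sigma> x + \<sigma> y" "\<sigma> (x * y) = \<sigma> x * \<sigma> y" for x y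
    using \<sigma> by (auto simp: field_automorphism_def)
  have "card (UNIV - {0, 1 :: 'a}) = 30" by (simp add: card_Diff_subset card_field)
  then have "UNIV - {0, 1 :: 'a} \<noteq> {}" by (metis card.empty zero_neq_numeral)
  then obtain g :: 'a where g: "g \<noteq> 0" "g \<noteq> 1" by blast
  define g1 where "g1 = g\<^sup>2"
  define g2 where "g2 = g1\<^sup>2"
  define g3 where "g3 = g2\<^sup>2"
  define g4 where "g4 = g3\<^sup>2"
  have "g4\<^sup>2 = g ^ 32" by (simp add: g4_def g3_def g2_def g1_def flip: power_mult)
  then have g4: "g4\<^sup>2 = g" by (simp only: power_32)
  note conj = g1_def[symmetric] g2_def[symmetric] g3_def[symmetric] g4_def[symmetric] g4
  \<comment> \<open>The coefficients of \<open>\<Prod>\<^sub>i (X + g ^ (2 ^ i))\<close> are fixed by squaring, so they lie in \<open>GF(2)\<close>.\<close>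
  define e1 where "e1 = g + g1 + g2 + g3 + g4"
  define e2 where "e2 = g * g1 + g * g2 + g * g3 + g * g4 + g1 * g2 + g1 * g3 + g1 * g4 + g2 * g3 + g2 * g4 + g3 * g4"
  define e3 where "e3 = g * g1 * g2 + g * g1 * g3 + g * g1 * g4 + g * g2 * g3 + g * g2 * g4 + g * g3 * g4
     + g1 * g2 * g3 + g1 * g2 * g4 + g1 * g3 * g4 + g2 * g3 * g4"
  define e4 where "e4 = g * g1 * g2 * g3 + g * g1 * g2 * g4 + g * g1 * g3 * g4 + g * g2 * g3 * g4 + g1 * g2 * g3 * g4"
  define e5 where "e5 = g * g1 * g2 * g3 * g4"
  have fixed: "\<sigma> e = e" if "e\<^sup>2 = e" for e
  proof -
    have "e * (e - 1) = 0" using that by (simp add: algebra_simps power2_eq_square)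
    then have "e = 0 \<or> e = 1" by simp
    then show ?thesis using \<sigma> by auto
  qed
  have e: "e1\<^sup>2 = e1" "e2\<^sup>2 = e2" "e3\<^sup>2 = e3" "e4\<^sup>2 = e4" "e5\<^sup>2 = e5"
    unfolding e1_def e2_def e3_def e4_def e5_def
    by (simp_all only: square_add power_mult_distrib conj) (simp_all only: ac_simps)
  have prod: "(X + g) * (X + g1) * (X + g2) * (X + g3) * (X + g4)
     = X ^ 5 + e1 * X ^ 4 + e2 * X ^ 3 + e3 * X ^ 2 + e4 * X + e5" for X
    by (simp add: e1_def e2_def e3_def e4_def e5_def algebra_simps power2_eq_square power3_eq_cube
        power4_eq_xxxx power_numeral_odd)
  have "\<sigma> (g ^ 5 + e1 * g ^ 4 + e2 * g ^ 3 + e3 * g ^ 2 + e4 * g + e5)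
     = (\<sigma> g) ^ 5 + e1 * (\<sigma> g) ^ 4 + e2 * (\<sigma> g) ^ 3 + e3 * (\<sigma> g) ^ 2 + e4 * \<sigma> g + e5"
    by (simp add: hom field_automorphism_power[OF \<sigma>] fixed e)
  moreover have "g ^ 5 + e1 * g ^ 4 + e2 * g ^ 3 + e3 * g ^ 2 + e4 * g + e5 = 0"
    unfolding prod[symmetric] by (simp add: add_self)
  ultimately have "(\<sigma> g + g) * (\<sigma> g + g1) * (\<sigma> g + g2) * (\<sigma> g + g3) * (\<sigma> g + g4) = 0"
    unfolding prod using \<sigma> by simp
  then have "\<sigma> g = g \<or> \<sigma> g = g1 \<or> \<sigma> g = g2 \<or> \<sigma> g = g3 \<or> \<sigma> g = g4"
    by (simp add: add_eq_0_char2 disj_assoc)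
  moreover have "g = g ^ (2 ^ 0)" "g1 = g ^ (2 ^ 1)" "g2 = g ^ (2 ^ 2)" "g3 = g ^ (2 ^ 3)" "g4 = g ^ (2 ^ 4)"
    by (simp_all add: g4_def g3_def g2_def g1_def flip: power_mult)
  ultimately have "\<sigma> g = g ^ (2 ^ 0) \<or> \<sigma> g = g ^ (2 ^ 1) \<or> \<sigma> g = g ^ (2 ^ 2) \<or> \<sigma> g = g ^ (2 ^ 3) \<or> \<sigma> g = g ^ (2 ^ 4)"
    by (elim disjE) (simp_all only: simp_thms)
  moreover have "(0::nat) < 5" "(1::nat) < 5" "(2::nat) < 5" "(3::nat) < 5" "(4::nat) < 5" by simp_all
  ultimately obtain i where i: "i < 5" "\<sigma> g = g ^ (2 ^ i)" by blast
  have "card ((\<lambda>k. g ^ k) ` {..<31}) = 31" using inj_on_power_31[OF g] by (simp add: card_image)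
  then have "(\<lambda>k. g ^ k) ` {..<31} = UNIV - {0}"
    using g by (intro card_subset_eq) (auto simp: card_field)
  have "\<sigma> x = x ^ (2 ^ i)" for x
  proof (cases "x = 0")
    case False
    then have "x \<in> (\<lambda>k. g ^ k) ` {..<31}" using \<open>_ = UNIV - {0}\<close> by simp
    then obtain k where "x = g ^ k" by blast
    then show ?thesis by (simp add: field_automorphism_power[OF \<sigma>] i(2) mult.commute flip: power_mult)
  qed (simp add: \<sigma>)
  then show ?thesis using i(1) by blast
qed

end

section \<open>Reduction of proper Mathon arcs to normal form\<close>

text \<open>The linear part of \<open>arc_iso\<close>. \<open>arc_from\<close> permits only linear
  changes of coordinates, so the reduction is kept free of field automorphisms.\<close>

definition pgl_equiv :: "('a::{field,finite} ^ 3) set set \<Rightarrow> ('a ^ 3) set set \<Rightarrow> bool" where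
  "pgl_equiv K K' \<longleftrightarrow> (\<exists>M :: 'a ^ 3 ^ 3. invertible M \<and> image ((*v) M) ` K = K')"

lemma pgl_equiv_trans:
  assumes "pgl_equiv K K'" "pgl_equiv K' K''"
  shows "pgl_equiv K K''"
proof -
  obtain M N where MN: "invertible M" "image ((*v) M) ` K = K'" "invertible N" "image ((*v) N) ` K' = K''"
    using assms unfolding pgl_equiv_def by blast
  have "image ((*v) (N ** M)) ` K = image ((*v) N) ` image ((*v) M) ` K"
    by (simp add: image_image matrix_vector_mul_assoc)
  then have "image ((*v) (N ** M)) ` K = K''" by (simp only: MN)
  then show ?thesis unfolding pgl_equiv_def
    by (intro exI[of _ "N ** M"] conjI invertible_mult MN(1,3))
qed

lemma pgl_equiv_sym:
  assumes "pgl_equiv K K'"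
  shows "pgl_equiv K' K"
proof -
  obtain M where M: "invertible M" "image ((*v) M) ` K = K'" using assms unfolding pgl_equiv_def by blast
  then obtain N where N: "N ** M = mat 1" "M ** N = mat 1" by (auto simp: invertible_def)
  then have "image ((*v) N) ` K' = K" unfolding M(2)[symmetric] by (simp add: image_image matrix_vector_mul_assoc)
  then show ?thesis unfolding pgl_equiv_def using N invertible_def by blast
qed

lemma arc_from_iff:
  "arc_from C K \<longleftrightarrow> (\<exists>d. maximal_arc d K) \<and> pgl_equiv (conic_arc C) K"
  unfolding arc_from_def pgl_equiv_def conic_arc_def PGL3_def by auto

lemma pgl_equiv_arc_iso: "pgl_equiv K K' \<Longrightarrow> (K, K') \<in> arc_iso"
  using arc_iso_PGL3 unfolding pgl_equiv_def by blast

context gf32 begin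

lemma pgl_equiv_conic_arc:
  fixes a b c d e f r :: 'a
  assumes "a * d + b * c \<noteq> 0" "r \<noteq> 0"
    and "\<And>\<alpha> \<beta> l. (\<alpha>, \<beta>, l) \<in> C \<Longrightarrow> \<exists>\<alpha>' \<beta>' l'. h (\<alpha>, \<beta>, l) = (\<alpha>', \<beta>', l') \<and>
      \<alpha>' * a\<^sup>2 + a * c + \<beta>' * c\<^sup>2 + l' * e\<^sup>2 = (a * d + b * c) * \<alpha> \<and>
      \<alpha>' * b\<^sup>2 + b * d + \<beta>' * d\<^sup>2 + l' * f\<^sup>2 = (a * d + b * c) * \<beta> \<and> l' * r\<^sup>2 = (a * d + b * c) * l"
  shows "pgl_equiv (conic_arc C) (conic_arc (h ` C))"
  by (rule conic_arc_transform[where a = a and b = b and c = c and d = d and e = e and f = f and r = r and C = C and h = h])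
     (use assms in \<open>auto simp: pgl_equiv_def\<close>)

text \<open>The disjointness trace of two members is the sum of the values Tr(\<alpha> \<beta>) of
  the two conics and of their composition, and 1 + 1 + 1 = 1.\<close>

lemma closed_conics_disjoint:
  assumes "closed_conics (C :: ('a \<times> 'a \<times> 'a) set)"
  shows "disjoint_conics C"
proof -
  have tr: "Tr (\<alpha> * \<beta>) = 1 \<and> l \<noteq> 0" if "(\<alpha>, \<beta>, l) \<in> C" for \<alpha> \<beta> l
    using assms that by (fastforce simp: closed_conics_def abs_trace_eq)
  have "conic_points c \<inter> conic_points c' = {}" if c: "c \<in> C" "c' \<in> C" "c \<noteq> c'" for c c'
  proof -
    obtain \<alpha> \<beta> l \<alpha>' \<beta>' l' where eq: "c = (\<alpha>, \<beta>, l)" "c' = (\<alpha>', \<beta>', l')" by (metis prod_cases3)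
    have "l \<noteq> l'"
    proof
      assume "l = l'"
      moreover have "inj_on (\<lambda>(\<alpha>, \<beta>, l). l) C" using assms by (simp add: closed_conics_def)
      ultimately have "c = c'" using c by (elim inj_onD) (simp_all add: eq)
      then show False using c(3) by simp
    qed
    define s where "s = l + l'"
    have s: "s \<noteq> 0" using \<open>l \<noteq> l'\<close> by (simp add: s_def add_eq_0_char2)
    have "conic_comp c c' \<in> C" using assms c unfolding closed_conics_def by blast
    then have "((\<alpha> * l + \<alpha>' * l') / s, (\<beta> * l + \<beta>' * l') / s, s) \<in> C" by (simp add: eq s_def)
    then have tr_s: "Tr ((\<alpha> * l + \<alpha>' * l') / s * ((\<beta> * l + \<beta>' * l') / s)) = 1" using tr by blast
    have div: "(P * s\<^sup>2 + Q * R) / s\<^sup>2 = P + Q / s * (R / s)" for P Q R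
      using s by (simp add: field_simps power2_eq_square)
    have "(l' * \<alpha> + l * \<alpha>') * (l' * \<beta> + l * \<beta>')
      = (\<alpha> * \<beta> + \<alpha>' * \<beta>') * s\<^sup>2 + (\<alpha> * l + \<alpha>' * l') * (\<beta> * l + \<beta>' * l')"
      by (simp add: s_def algebra_simps power2_eq_square char_2)
    then have "(l' * \<alpha> + l * \<alpha>') * (l' * \<beta> + l * \<beta>') / s\<^sup>2
      = \<alpha> * \<beta> + \<alpha>' * \<beta>' + (\<alpha> * l + \<alpha>' * l') / s * ((\<beta> * l + \<beta>' * l') / s)"
      by (simp only: div)
    then have "disjointness_trace c c' = Tr (\<alpha> * \<beta>) + Tr (\<alpha>' * \<beta>') + 1"
      by (simp only: disjointness_trace_def eq prod.case s_def[symmetric] Tr_add tr_s)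
    then have "disjointness_trace c c' = 1"
      using tr[of \<alpha> \<beta> l] tr[of \<alpha>' \<beta>' l'] c by (simp add: eq add_self)
    then show ?thesis unfolding eq using \<open>l \<noteq> l'\<close> tr c eq by (intro conic_points_disjointI) auto
  qed
  moreover have "\<forall>(\<alpha>, \<beta>, l)\<in>C. l \<noteq> 0" using tr by blast
  ultimately show ?thesis unfolding disjoint_conics_def disjoint_family_on_def by blast
qed

section \<open>Closed sets as polynomial families\<close>

lemma subgroup_basis:
  assumes A: "additive_subgroup A" and card_A: "card A = 8"
  obtains u v w :: 'a where "u \<noteq> 0" "v \<notin> {0, u}" "w \<notin> {0, u, v, u + v}"
    "A = {0, u, v, u + v, w, u + w, v + w, u + v + w}"
proof -
  have "\<exists>x. x \<in> A - S" if "card S < 8" for S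
  proof (rule ccontr)
    assume "\<not> ?thesis"
    then have "card A \<le> card S" by (intro card_mono) auto
    then show False using that card_A by simp
  qed note new = this
  have "card {0 :: 'a} < 8" by simp
  then obtain u where u: "u \<in> A" "u \<noteq> 0" using new by blast
  have "card {0, u} < 8" by (rule le_less_trans[OF card_insert_le_m1]) auto
  then obtain v where v: "v \<in> A" "v \<notin> {0, u}" using new by blast
  have "card {0, u, v, u + v} \<le> 4" using card_length[of "[0, u, v, u + v]"] by simp
  then obtain w where w: "w \<in> A" "w \<notin> {0, u, v, u + v}" using new[of "{0, u, v, u + v}"] by auto
  let ?S = "{0, u, v, u + v, w, u + w, v + w, u + v + w}"
  have "w \<noteq> u" "w \<noteq> v" "w \<noteq> 0" "u \<noteq> v" "v \<noteq> 0" "w \<noteq> u + v" using v w by auto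
  moreover from \<open>w \<noteq> u + v\<close> have "u + w \<noteq> v" "v + w \<noteq> u" "u + v \<noteq> w" "u + (v + w) \<noteq> 0"
    by (auto simp: char_2 add_ac) (simp add: add_eq_0_char2 flip: add.assoc)
  ultimately have "distinct [0, u, v, u + v, w, u + w, v + w, u + v + w]"
    using u by (simp add: add_eq_0_char2 add.assoc add.left_commute[of v u] eq_commute[of 0])
  then have "card ?S = 8" using distinct_card by fastforce
  moreover have "?S \<subseteq> A" using A u v w by (auto simp: additive_subgroup_iff)
  ultimately have "A = ?S" using card_A by (intro card_subset_eq[symmetric]) auto
  then show thesis by (rule that[OF u(2) v(2) w(2)])
qed

text \<open>Three independent values determine an additive function on A, and the linearised
  monomials x, x^2, x^4 suffice to match them. Division by x later gives the exponents 0, 1,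
  3.\<close>

lemma additive_interpolation:
  fixes P :: "'a \<Rightarrow> 'a"
  assumes A: "additive_subgroup A" "card A = 8"
    and P: "\<And>x y. x \<in> A \<Longrightarrow> y \<in> A \<Longrightarrow> P (x + y) = P x + P y"
  shows "\<exists>c0 c1 c2. \<forall>x\<in>A. P x = c0 * x + c1 * x ^ 2 + c2 * x ^ 4"
proof -
  obtain u v w where uvw: "u \<noteq> 0" "v \<notin> {0, u}" "w \<notin> {0, u, v, u + v}"
    and A_eq: "A = {0, u, v, u + v, w, u + w, v + w, u + v + w}"
    by (rule subgroup_basis[OF A])
  \<comment> \<open>Newton interpolation with the linearised polynomials \<open>L2\<close>, \<open>L3\<close> vanishing on \<open>\<langle>u\<rangle>\<close>, \<open>\<langle>u, v\<rangle>\<close>.\<close>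
  define L2 where "L2 x = x\<^sup>2 + u * x" for x
  define m where "m = L2 v"
  define L3 where "L3 x = (L2 x)\<^sup>2 + m * L2 x" for x
  have L2_add: "L2 (x + y) = L2 x + L2 y" for x y by (simp add: L2_def square_add algebra_simps)
  have L3_add: "L3 (x + y) = L3 x + L3 y" for x y by (simp add: L3_def L2_add square_add algebra_simps)
  have L2_eq: "L2 x = x * (x + u)" for x by (simp add: L2_def algebra_simps power2_eq_square)
  have m: "m \<noteq> 0" using uvw by (simp add: m_def L2_eq add_eq_0_char2)
  \<comment> \<open>The factors are w (w + u) and (w + v) (w + v + u), nonzero because w is outside
    the span of u and v.\<close>
  have "L3 w = L2 w * L2 (w + v)"
    unfolding L2_add by (simp add: L3_def m_def algebra_simps power2_eq_square)
  moreover have "L2 w \<noteq> 0" using uvw by (simp add: L2_eq add_eq_0_char2)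
  moreover have "w + v \<noteq> u" using uvw by (metis add_self_left add.commute insertCI)
  then have "L2 (w + v) \<noteq> 0" using uvw by (auto simp add: L2_eq add_eq_0_char2)
  ultimately have L3w: "L3 w \<noteq> 0" by simp
  have zero: "L2 u = 0" "L3 u = 0" "L3 v = 0" by (simp_all add: L3_def L2_eq add_self m_def power2_eq_square)
  define p0 where "p0 = P u / u"
  define p1 where "p1 = (P v + p0 * v) / m"
  define p2 where "p2 = (P w + p0 * w + p1 * L2 w) / L3 w"
  define Q where "Q x = p0 * x + p1 * L2 x + p2 * L3 x" for x
  have Q_add: "Q (x + y) = Q x + Q y" for x y by (simp add: Q_def L2_add L3_add algebra_simps)
  have "Q u = P u" using uvw by (simp add: Q_def zero p0_def)
  moreover have "Q v = P v" using m by (simp add: Q_def zero p1_def char_2 add_ac flip: m_def)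
  moreover have "Q w = P w" using L3w by (simp add: Q_def p2_def char_2 add_ac)
  moreover have P0: "P 0 = 0" using P[of 0 0] A(1) by (simp add: additive_subgroup_def add_self)
  moreover have "Q 0 = 0" by (simp add: Q_def L3_def L2_def)
  moreover have "P (u + v) = P u + P v" "P (u + w) = P u + P w" "P (v + w) = P v + P w"
    "P (u + v + w) = P u + P v + P w"
    by (simp_all add: P A_eq)
  ultimately have PQ: "P x = Q x" if "x \<in> A" for x using that by (auto simp: A_eq Q_add)
  have Q_eq: "Q x = (p0 + p1 * u + p2 * m * u) * x + (p1 + p2 * (u\<^sup>2 + m)) * x ^ 2 + p2 * x ^ 4" for x
    by (simp add: Q_def L3_def L2_def square_add power_mult_distrib flip: power_mult)
       (simp add: algebra_simps)
  show ?thesis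
    by (intro exI ballI) (simp only: PQ Q_eq)
qed

lemma closed_conics_family:
  assumes C: "closed_conics (C :: ('a \<times> 'a \<times> 'a) set)" and card_C: "card C = 7"
  obtains A c0 c1 c2 d0 d1 d2 where "additive_subgroup A" "card A = 8"
    "C = conic_family (\<lambda>l. c0 + c1 * l + c2 * l ^ 3) (\<lambda>l. d0 + d1 * l + d2 * l ^ 3) A"
proof -
  define lam where "lam = (\<lambda>(\<alpha> :: 'a, \<beta> :: 'a, l :: 'a). l)"
  have inj: "inj_on lam C" using C by (simp add: closed_conics_def lam_def)
  have nz: "lam c \<noteq> 0" if "c \<in> C" for c using C that by (auto simp: closed_conics_def lam_def)
  define A where "A = insert 0 (lam ` C)"
  have A0: "A - {0} = lam ` C" using nz by (auto simp: A_def)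
  have "0 \<notin> lam ` C" using nz by force
  then have card_A: "card A = 8" using inj card_C by (simp add: A_def card_image)
  define g where "g = inv_into C lam"
  define p where "p l = fst (g l)" for l
  define r where "r l = fst (snd (g l))" for l
  have g: "g (lam c) = c" if "c \<in> C" for c using inj that by (simp add: g_def)
  have gl: "(p l, r l, l) = g l" "g l \<in> C" if l: "l \<in> A - {0}" for l
  proof -
    obtain \<alpha> \<beta> where c: "(\<alpha>, \<beta>, l) \<in> C" using l A0 by (auto simp: lam_def)
    then have "g l = (\<alpha>, \<beta>, l)" using g[OF c] by (simp add: lam_def)
    then show "(p l, r l, l) = g l" "g l \<in> C" using c by (simp_all add: p_def r_def)
  qed
  have C_eq: "C = conic_family p r A"
  proof -
    have "conic_family p r A = g ` (A - {0})" unfolding conic_family_def using gl(1) by (intro image_cong) auto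
    also have "\<dots> = C" using g by (simp add: A0 image_image)
    finally show ?thesis ..
  qed
  have comp: "x + y \<in> A - {0} \<and> (x + y) * p (x + y) = x * p x + y * p y \<and> (x + y) * r (x + y) = x * r x + y * r y"
    if xy: "x \<in> A - {0}" "y \<in> A - {0}" "x \<noteq> y" for x y
  proof -
    have "(p x, r x, x) \<in> C" "(p y, r y, y) \<in> C" using xy(1,2) by (simp_all only: gl)
    moreover have "(p x, r x, x) \<noteq> (p y, r y, y)" using xy(3) by simp
    ultimately have *: "conic_comp (p x, r x, x) (p y, r y, y) \<in> C" using C unfolding closed_conics_def by blast
    have s: "x + y \<noteq> 0" using xy(3) by (simp add: add_eq_0_char2)
    from * obtain l where "l \<in> A - {0}" "conic_comp (p x, r x, x) (p y, r y, y) = (p l, r l, l)"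
      unfolding C_eq conic_family_def by blast
    then show ?thesis using s by (auto simp: field_simps)
  qed
  have sub: "additive_subgroup A"
    unfolding additive_subgroup_iff
  proof (intro conjI ballI)
    fix x y assume "x \<in> A" "y \<in> A"
    then show "x + y \<in> A" using comp[of x y] by (cases "x = 0 \<or> y = 0 \<or> x = y") (auto simp: add_self A_def)
  qed (simp add: A_def)
  \<comment> \<open>Composition speaks only of distinct nonzero x and y. If one is 0 or both are
    equal, the claim still holds, as the arbitrary value of p or r at 0 is multiplied by 0.\<close>
  have add: "(x + y) * p (x + y) = x * p x + y * p y" "(x + y) * r (x + y) = x * r x + y * r y"
    if "x \<in> A" "y \<in> A" for x y
    using comp[of x y] that by (cases "x = 0 \<or> y = 0 \<or> x = y"; auto simp: add_self)+
  obtain c0 c1 c2 where c: "\<And>x. x \<in> A \<Longrightarrow> x * p x = c0 * x + c1 * x ^ 2 + c2 * x ^ 4"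
    using additive_interpolation[OF sub card_A, of "\<lambda>x. x * p x"] add by blast
  obtain d0 d1 d2 where d: "\<And>x. x \<in> A \<Longrightarrow> x * r x = d0 * x + d1 * x ^ 2 + d2 * x ^ 4"
    using additive_interpolation[OF sub card_A, of "\<lambda>x. x * r x"] add by blast
  have "p x = c0 + c1 * x + c2 * x ^ 3" "r x = d0 + d1 * x + d2 * x ^ 3" if "x \<in> A - {0}" for x
  proof -
    have "x * p x = x * (c0 + c1 * x + c2 * x ^ 3)" "x * r x = x * (d0 + d1 * x + d2 * x ^ 3)"
      using c[of x] d[of x] that
      by (simp_all add: algebra_simps power2_eq_square power3_eq_cube power4_eq_xxxx)
    then show "p x = c0 + c1 * x + c2 * x ^ 3" "r x = d0 + d1 * x + d2 * x ^ 3" using that by simp_all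
  qed
  then have "C = conic_family (\<lambda>l. c0 + c1 * l + c2 * l ^ 3) (\<lambda>l. d0 + d1 * l + d2 * l ^ 3) A"
    unfolding C_eq conic_family_def by (intro image_cong) auto
  then show thesis using that sub card_A by blast
qed

text \<open>The linear terms of \<alpha> and \<beta> cancel, since y (k1 x) + x (k1 y) = 0; this
  matches the fact that a substitution in z removes them.\<close>

lemma disjointness_trace_family:
  assumes "x \<noteq> y"
  shows "disjointness_trace (c0 + c1 * x + c2 * x ^ 3, d0 + d1 * x + d2 * x ^ 3, x)
      (c0 + c1 * y + c2 * y ^ 3, d0 + d1 * y + d2 * y ^ 3, y)
    = Tr ((c0 + c2 * (x * y * (x + y))) * (d0 + d2 * (x * y * (x + y))))"
proof -
  have s: "x + y \<noteq> 0" using assms by (simp add: add_eq_0_char2)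
  have "y * (k0 + k1 * x + k2 * x ^ 3) + x * (k0 + k1 * y + k2 * y ^ 3)
      = (k0 + k2 * (x * y * (x + y))) * (x + y)" for k0 k1 k2
    by (simp add: power3_eq_cube algebra_simps char_2)
  then show ?thesis using s by (simp add: disjointness_trace_def power2_eq_square)
qed

lemma conic_family_scale:
  assumes "k \<noteq> (0 :: 'a)"
  shows "conic_family p r ((*) k ` A) = (\<lambda>l. (p (k * l), r (k * l), k * l)) ` (A - {0})"
proof -
  have "(*) k ` A - {0} = (*) k ` (A - {0})" using assms by auto
  then show ?thesis by (simp add: conic_family_def image_image)
qed

lemma additive_subgroup_scale: "additive_subgroup A \<Longrightarrow> additive_subgroup ((*) (k :: 'a) ` A)"
  unfolding additive_subgroup_def by (force simp flip: right_diff_distrib)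

section \<open>Coordinate changes leading to the normal form\<close>

lemma pgl_equiv_shift:
  "pgl_equiv (conic_arc (conic_family (\<lambda>l. c0 + c1 * l + c2 * l ^ 3) (\<lambda>l. d0 + d1 * l + d2 * l ^ 3) A))
     (conic_arc (conic_family (\<lambda>l. c0 + c2 * l ^ 3) (\<lambda>l. d0 + d2 * l ^ 3) (A :: 'a set)))"
proof -
  obtain e f where ef: "e\<^sup>2 = c1" "f\<^sup>2 = d1" using square_surj by metis
  define h where "h = (\<lambda>(\<alpha>, \<beta>, l). (\<alpha> + c1 * l, \<beta> + d1 * l, l :: 'a))"
  let ?C = "conic_family (\<lambda>l. c0 + c1 * l + c2 * l ^ 3) (\<lambda>l. d0 + d1 * l + d2 * l ^ 3) A"
  have "pgl_equiv (conic_arc ?C) (conic_arc (h ` ?C))"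
    by (rule pgl_equiv_conic_arc[where a = 1 and b = 0 and c = 0 and d = 1 and e = e and f = f and r = 1])
       (auto simp: h_def ef add.assoc mult.commute add_self)
  moreover have "h ` ?C = conic_family (\<lambda>l. c0 + c2 * l ^ 3) (\<lambda>l. d0 + d2 * l ^ 3) A"
    by (simp add: conic_family_def h_def image_image char_2 add_ac)
  ultimately show ?thesis by simp
qed

text \<open>Scaling y by \<beta> brings the second coefficient to the value 1 that
  \<open>denniston_type\<close> demands, at the price of scaling the subgroup.\<close>

lemma pgl_equiv_denniston:
  assumes "Tr (\<alpha> * \<beta>) = 1"
  shows "pgl_equiv (conic_arc (conic_family (\<lambda>_. \<alpha>) (\<lambda>_. \<beta>) A))
     (conic_arc (conic_family (\<lambda>_. \<alpha> * \<beta>) (\<lambda>_. 1) ((*) \<beta> ` A)))"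
proof -
  have \<beta>: "\<beta> \<noteq> 0" using assms by auto
  define h where "h = (\<lambda>(\<alpha>' :: 'a, \<beta>' :: 'a, l). (\<alpha> * \<beta>, 1 :: 'a, \<beta> * l))"
  let ?C = "conic_family (\<lambda>_. \<alpha>) (\<lambda>_. \<beta>) A"
  have "pgl_equiv (conic_arc ?C) (conic_arc (h ` ?C))"
    by (rule pgl_equiv_conic_arc[where a = 1 and b = 0 and c = 0 and d = \<beta> and e = 0 and f = 0 and r = 1])
       (auto simp: h_def \<beta> conic_family_def mult.commute power2_eq_square)
  moreover have "h ` ?C = conic_family (\<lambda>_. \<alpha> * \<beta>) (\<lambda>_. 1) ((*) \<beta> ` A)"
    by (simp add: conic_family_scale[OF \<beta>]) (simp add: conic_family_def h_def image_image)
  ultimately show ?thesis by simp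
qed

text \<open>Invariance of the Arf invariant.\<close>

lemma Tr_sl2:
  assumes "a * d + b * c = (1 :: 'a)"
  shows "Tr ((\<alpha> * a\<^sup>2 + a * c + \<beta> * c\<^sup>2) * (\<alpha> * b\<^sup>2 + b * d + \<beta> * d\<^sup>2)) = Tr (\<alpha> * \<beta>)"
proof -
  \<comment> \<open>The Artin-Schreier witness: the two products differ by q^2 + q, which has trace
    0.\<close>
  define q where "q = \<alpha> * a * b + \<beta> * c * d + a * d"
  have bc: "b * c = a * d + 1"
    by (metis assms add_self_left)
  have "(\<alpha> * a\<^sup>2 + a * c + \<beta> * c\<^sup>2) * (\<alpha> * b\<^sup>2 + b * d + \<beta> * d\<^sup>2)
     = \<alpha> * \<beta> * (a * d + b * c)\<^sup>2 + (\<alpha> * a * b)\<^sup>2 + (\<beta> * c * d)\<^sup>2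
       + (\<alpha> * a * b + \<beta> * c * d) * (a * d + b * c) + (a * d) * (b * c)"
    by (simp add: algebra_simps power2_eq_square char_2)
  also have "\<dots> = \<alpha> * \<beta> + (q\<^sup>2 + q)"
    unfolding assms bc q_def square_add by (simp add: algebra_simps power2_eq_square char_2)
  finally show ?thesis by (simp add: Tr_add Tr_square add_self)
qed

text \<open>Under the matrix with rows (a, b), (c, d) a \<lambda>^3 coefficient 1 in \<beta> alone
  becomes c^2 in \<alpha> and d^2 in \<beta>. So c and d are the square roots of \<open>c2\<close>
  and \<open>d2\<close>, and a, b complete them to determinant 1.\<close>

lemma pgl_equiv_leading_coefficient:
  assumes "c2 \<noteq> 0 \<or> d2 \<noteq> 0" and "A - {0} \<noteq> {}"
    and tr: "\<And>x y. x \<in> A - {0} \<Longrightarrow> y \<in> A - {0} \<Longrightarrow> x \<noteq> y \<Longrightarrow>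
      Tr ((c0 + c2 * (x * y * (x + y))) * (d0 + d2 * (x * y * (x + y)))) = 1"
  obtains m n where "\<And>x y. x \<in> A - {0} \<Longrightarrow> y \<in> A - {0} \<Longrightarrow> x \<noteq> y \<Longrightarrow> Tr (m * (n + x * y * (x + y))) = 1"
    "pgl_equiv (conic_arc (conic_family (\<lambda>l. c0 + c2 * l ^ 3) (\<lambda>l. d0 + d2 * l ^ 3) A))
       (conic_arc (conic_family (\<lambda>_. m) (\<lambda>l. n + l ^ 3) (A :: 'a set)))"
proof -
  obtain c d where cd: "c\<^sup>2 = c2" "d\<^sup>2 = d2" using square_surj by metis
  obtain a b where ab: "a * d + b * c = 1"
  proof (cases "d = 0")
    case True
    then show thesis using that[of 0 "1 / c"] assms(1) cd by auto
  next
    case False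
    then show thesis using that[of "1 / d" 0] by simp
  qed
  have sq: "a\<^sup>2 * d\<^sup>2 + b\<^sup>2 * c\<^sup>2 = 1"
    using arg_cong[OF ab, of "\<lambda>x. x\<^sup>2"] by (simp add: square_add power_mult_distrib)
  \<comment> \<open>Cramer's rule for m a^2 + n c^2 = c0 + a c and m b^2 + n d^2 = d0 + b d; by
    \<open>sq\<close> the determinant is 1.\<close>
  define m where "m = d\<^sup>2 * (c0 + a * c) + c\<^sup>2 * (d0 + b * d)"
  define n where "n = b\<^sup>2 * (c0 + a * c) + a\<^sup>2 * (d0 + b * d)"
  have form_eq: "m * a\<^sup>2 + a * c + (n + t) * c\<^sup>2 = c0 + c2 * t" "m * b\<^sup>2 + b * d + (n + t) * d\<^sup>2 = d0 + d2 * t" for t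
  proof -
    have "m * a\<^sup>2 + a * c + (n + t) * c\<^sup>2 = (a\<^sup>2 * d\<^sup>2 + b\<^sup>2 * c\<^sup>2) * (c0 + a * c) + (a * c + c\<^sup>2 * t)"
      by (simp add: m_def n_def algebra_simps char_2)
    also have "\<dots> = c0 + c2 * t" unfolding sq by (simp add: cd add.assoc add_self_left)
    finally show "m * a\<^sup>2 + a * c + (n + t) * c\<^sup>2 = c0 + c2 * t" .
    have "m * b\<^sup>2 + b * d + (n + t) * d\<^sup>2 = (a\<^sup>2 * d\<^sup>2 + b\<^sup>2 * c\<^sup>2) * (d0 + b * d) + (b * d + d\<^sup>2 * t)"
      by (simp add: m_def n_def algebra_simps char_2)
    also have "\<dots> = d0 + d2 * t" unfolding sq by (simp add: cd add.assoc add_self_left)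
    finally show "m * b\<^sup>2 + b * d + (n + t) * d\<^sup>2 = d0 + d2 * t" .
  qed
  have "Tr (m * (n + x * y * (x + y))) = 1" if "x \<in> A - {0}" "y \<in> A - {0}" "x \<noteq> y" for x y
    using tr[OF that] Tr_sl2[OF ab, of m "n + x * y * (x + y)"] by (simp only: form_eq)
  moreover have "pgl_equiv (conic_arc (conic_family (\<lambda>l. c0 + c2 * l ^ 3) (\<lambda>l. d0 + d2 * l ^ 3) A))
       (conic_arc (conic_family (\<lambda>_. m) (\<lambda>l. n + l ^ 3) A))"
  proof -
    define h where "h = (\<lambda>(\<alpha> :: 'a, \<beta> :: 'a, l). (m, n + l ^ 3, l :: 'a))"
    let ?C = "conic_family (\<lambda>l. c0 + c2 * l ^ 3) (\<lambda>l. d0 + d2 * l ^ 3) A"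
    have "pgl_equiv (conic_arc ?C) (conic_arc (h ` ?C))"
      by (rule pgl_equiv_conic_arc[where a = a and b = b and c = c and d = d and e = 0 and f = 0 and r = 1])
         (auto simp: h_def ab conic_family_def form_eq)
    moreover have "h ` ?C = conic_family (\<lambda>_. m) (\<lambda>l. n + l ^ 3) A"
      by (simp add: conic_family_def h_def image_image)
    ultimately show ?thesis by simp
  qed
  ultimately show thesis using that by blast
qed

lemma pgl_equiv_mathon_conics:
  assumes A: "additive_subgroup A" "card A = 8"
    and tr: "\<And>x y. x \<in> A - {0} \<Longrightarrow> y \<in> A - {0} \<Longrightarrow> x \<noteq> y \<Longrightarrow> Tr (m * (n + x * y * (x + y))) = 1"
  obtains B where "isotropic B"
    "pgl_equiv (conic_arc (conic_family (\<lambda>_. m) (\<lambda>l. n + l ^ 3) A)) (conic_arc (mathon_conics B))"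
proof -
  obtain u v w where uvw: "u \<noteq> 0" "v \<notin> {0, u}" "w \<notin> {0, u, v, u + v}"
    and A_eq: "A = {0, u, v, u + v, w, u + w, v + w, u + v + w}"
    by (rule subgroup_basis[OF A])
  have uvw_A: "u \<in> A - {0}" "v \<in> A - {0}" "w \<in> A - {0}" "v + w \<in> A - {0}" "u \<noteq> v" "u \<noteq> w" "u \<noteq> v + w"
    using uvw by (auto simp: A_eq add_eq_0_char2 char_2 add_ac)
  have m: "m \<noteq> 0" using tr[of u v] uvw_A by auto
  obtain k where k: "k ^ 3 = m" using cube_surj by blast
  then have k0: "k \<noteq> 0" using m by auto
  have mn: "Tr (m * n) + Tr (m * (x * y * (x + y))) = 1" if "x \<in> A - {0}" "y \<in> A - {0}" "x \<noteq> y" for x y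
    using tr[OF that] by (simp add: distrib_left Tr_add)
  have tau: "Tr (m * n) = 1"
  proof (rule ccontr)
    \<comment> \<open>The trace of m x y (x + y) would be 1 on all pairs of distinct nonzero
      elements, but its values at (u, v) and (u, w) add up to the value at (u, v + w).\<close>
    assume "Tr (m * n) \<noteq> 1"
    then have "Tr (m * n) = 0" using Tr_cases by blast
    then have one: "Tr (m * (x * y * (x + y))) = 1" if "x \<in> A - {0}" "y \<in> A - {0}" "x \<noteq> y" for x y
      using mn[OF that] by simp
    have "m * (u * (v + w) * (u + (v + w))) = m * (u * v * (u + v)) + m * (u * w * (u + w))"
      by (simp add: algebra_simps char_2)
    then have "Tr (m * (u * (v + w) * (u + (v + w)))) = Tr (m * (u * v * (u + v))) + Tr (m * (u * w * (u + w)))"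
      by (simp add: Tr_add)
    moreover have "Tr (m * (u * (v + w) * (u + (v + w)))) = 1" "Tr (m * (u * v * (u + v))) = 1" "Tr (m * (u * w * (u + w))) = 1"
      by (rule one; use uvw_A in simp)+
    ultimately show False by (simp add: add_self)
  qed
  then have "Tr (m * n + 1) = 0" by (simp add: Tr_add add_self)
  then obtain b where b: "m * n + 1 = b\<^sup>2 + b" using Tr_eq_0_iff by blast
  then have b': "b\<^sup>2 + b + 1 = m * n" by (metis add.commute add_self_left)
  define B where "B = (*) k ` A"
  have "card B = 8" unfolding B_def using A(2) k0 by (subst card_image) (auto intro: inj_onI)
  moreover have "Tr (x * y * (x + y)) = 0" if B: "x \<in> B" "y \<in> B" for x y
  proof -
    obtain x' y' where xy: "x = k * x'" "y = k * y'" "x' \<in> A" "y' \<in> A" using B by (auto simp: B_def)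
    have eq: "x * y * (x + y) = m * (x' * y' * (x' + y'))"
      by (simp add: xy k[symmetric] power3_eq_cube algebra_simps)
    show ?thesis
    proof (cases "x' = 0 \<or> y' = 0 \<or> x' = y'")
      case False
      then show ?thesis using mn[of x' y'] xy(3,4) tau unfolding eq by simp
    qed (auto simp: eq add_self)
  qed
  ultimately have "isotropic B"
    using additive_subgroup_scale[OF A(1)] by (simp add: isotropic_def B_def)
  moreover have "pgl_equiv (conic_arc (conic_family (\<lambda>_. m) (\<lambda>l. n + l ^ 3) A)) (conic_arc (mathon_conics B))"
  proof -
    define h where "h = (\<lambda>(\<alpha> :: 'a, \<beta> :: 'a, l). (1 :: 'a, 1 + (k * l) ^ 3, k * l))"
    let ?C = "conic_family (\<lambda>_. m) (\<lambda>l. n + l ^ 3) A"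
    have coeff: "b\<^sup>2 + b + (1 + (k * l) ^ 3) = m * (n + l ^ 3)" for l
      using b' by (simp add: distrib_left power_mult_distrib k add.assoc[symmetric])
    have "pgl_equiv (conic_arc ?C) (conic_arc (h ` ?C))"
    \<comment> \<open>Replacing x by m x + b y and z by k z turns the new equation into m times the
      old one: \<open>k ^ 3 = m\<close> settles the terms in \<lambda> and \<lambda>^3 at once, and
      b^2 + b + 1 = m n the constant part of \<beta>.\<close>
    proof (rule pgl_equiv_conic_arc[where a = m and b = b and c = 0 and d = 1 and e = 0 and f = 0 and r = k])
      fix \<alpha> \<beta> l assume "(\<alpha>, \<beta>, l) \<in> ?C"
      then have l: "\<alpha> = m" "\<beta> = n + l ^ 3" by (auto simp: conic_family_def)
      have "k * l * k\<^sup>2 = m * l" by (simp add: k[symmetric] power2_eq_square power3_eq_cube)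
      then show "\<exists>\<alpha>' \<beta>' l'. h (\<alpha>, \<beta>, l) = (\<alpha>', \<beta>', l') \<and>
          \<alpha>' * m\<^sup>2 + m * 0 + \<beta>' * 0\<^sup>2 + l' * 0\<^sup>2 = (m * 1 + b * 0) * \<alpha> \<and>
          \<alpha>' * b\<^sup>2 + b * 1 + \<beta>' * 1\<^sup>2 + l' * 0\<^sup>2 = (m * 1 + b * 0) * \<beta> \<and> l' * k\<^sup>2 = (m * 1 + b * 0) * l"
        using coeff[of l] by (simp add: h_def l power2_eq_square)
    qed (use m k0 in simp_all)
    moreover have "h ` ?C = mathon_conics B"
      unfolding mathon_conics_def B_def conic_family_scale[OF k0]
      by (simp add: conic_family_def h_def image_image)
    ultimately show ?thesis by simp
  qed
  ultimately show thesis using that by blast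
qed

lemma proper_mathon_arc_classification:
  assumes "proper_mathon_arc (K :: ('a ^ 3) set set)" "maximal_arc 8 K"
  obtains A where "isotropic A" "(K, conic_arc (mathon_conics A)) \<in> arc_iso"
proof -
  obtain C where C: "closed_conics C" "pgl_equiv (conic_arc C) K"
    using assms(1) unfolding proper_mathon_arc_def mathon_type_def arc_from_iff by blast
  obtain M :: "'a ^ 3 ^ 3" where M: "invertible M" "image ((*v) M) ` conic_arc C = K"
    using C(2) unfolding pgl_equiv_def by blast
  have disj: "disjoint_conics C" using C(1) by (rule closed_conics_disjoint)
  have "card C + 1 = 8" by (rule card_conics_of_maximal_arc[OF M(1) _ disj]) (simp add: M(2) assms(2))
  then have "card C = 7" by simp
  then obtain A c0 c1 c2 d0 d1 d2 where A: "additive_subgroup A" "card A = 8"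
    and C_eq: "C = conic_family (\<lambda>l. c0 + c1 * l + c2 * l ^ 3) (\<lambda>l. d0 + d1 * l + d2 * l ^ 3) A"
    using closed_conics_family[OF C(1)] by blast
  have tr: "Tr ((c0 + c2 * (x * y * (x + y))) * (d0 + d2 * (x * y * (x + y)))) = 1"
    if xy: "x \<in> A - {0}" "y \<in> A - {0}" "x \<noteq> y" for x y
  proof -
    define c where "c l = (c0 + c1 * l + c2 * l ^ 3, d0 + d1 * l + d2 * l ^ 3, l)" for l
    have "c x \<in> C" "c y \<in> C" "c x \<noteq> c y" using xy by (auto simp: C_eq conic_family_def c_def)
    then have "conic_points (c x) \<inter> conic_points (c y) = {}"
      using disj unfolding disjoint_conics_def disjoint_family_on_def by blast
    then have "disjointness_trace (c x) (c y) = 1"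
      unfolding c_def using xy by (intro conic_points_disjointD) auto
    then show ?thesis unfolding c_def disjointness_trace_family[OF xy(3)] .
  qed
  obtain u v w where uvw: "u \<noteq> 0" "v \<notin> {0, u}" "A = {0, u, v, u + v, w, u + w, v + w, u + v + w}"
    using subgroup_basis[OF A] by metis
  have equiv: "pgl_equiv (conic_arc C) (conic_arc (conic_family (\<lambda>l. c0 + c2 * l ^ 3) (\<lambda>l. d0 + d2 * l ^ 3) A))"
    unfolding C_eq by (rule pgl_equiv_shift)
  have "c2 \<noteq> 0 \<or> d2 \<noteq> 0"
  proof (rule ccontr)
    assume "\<not> ?thesis"
    then have zero: "c2 = 0" "d2 = 0" by simp_all
    have tr0: "Tr (c0 * d0) = 1" using tr[of u v] uvw by (auto simp: zero)
    define D where "D = conic_family (\<lambda>_. c0 * d0) (\<lambda>_. 1) ((*) d0 ` A)"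
    have "pgl_equiv (conic_arc C) (conic_arc D)"
      using equiv pgl_equiv_denniston[OF tr0, of A] pgl_equiv_trans unfolding D_def zero by fastforce
    then have "pgl_equiv (conic_arc D) K" using C(2) pgl_equiv_sym pgl_equiv_trans by blast
    then have "arc_from D K" using assms(2) by (auto simp: arc_from_iff)
    moreover have D_eq: "D = {(c0 * d0, 1, l) | l. l \<in> (*) d0 ` A - {0}}" by (auto simp: D_def conic_family_def)
    ultimately have "arc_from {(c0 * d0, 1, l) | l. l \<in> (*) d0 ` A - {0}} K" by (simp only:)
    moreover have "additive_subgroup ((*) d0 ` A)" by (rule additive_subgroup_scale[OF A(1)])
    ultimately have "denniston_type K"
      unfolding denniston_type_def abs_trace_eq additive_subgroup_def using tr0 by blast
    then show False using assms(1) by (simp add: proper_mathon_arc_def)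
  qed
  moreover have "A - {0} \<noteq> {}" using uvw by auto
  ultimately obtain m n where mn: "\<And>x y. x \<in> A - {0} \<Longrightarrow> y \<in> A - {0} \<Longrightarrow> x \<noteq> y \<Longrightarrow> Tr (m * (n + x * y * (x + y))) = 1"
    and equiv2: "pgl_equiv (conic_arc (conic_family (\<lambda>l. c0 + c2 * l ^ 3) (\<lambda>l. d0 + d2 * l ^ 3) A))
       (conic_arc (conic_family (\<lambda>_. m) (\<lambda>l. n + l ^ 3) A))"
    using pgl_equiv_leading_coefficient tr by blast
  obtain B where "isotropic B"
    and equiv3: "pgl_equiv (conic_arc (conic_family (\<lambda>_. m) (\<lambda>l. n + l ^ 3) A)) (conic_arc (mathon_conics B))"
    using pgl_equiv_mathon_conics[OF A mn] by blast
  have "pgl_equiv K (conic_arc (mathon_conics B))"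
    by (intro pgl_equiv_trans[OF pgl_equiv_sym[OF C(2)]] pgl_equiv_trans[OF equiv] pgl_equiv_trans[OF equiv2] equiv3)
  then show thesis using that \<open>isotropic B\<close> pgl_equiv_arc_iso by blast
qed

section \<open>Counting\<close>

definition pairing :: "'a \<Rightarrow> 'a \<Rightarrow> 'a" where
  "pairing x y = Tr (x * y * (x + y))"

text \<open>The square on y is moved to the other factor by applying Frobenius four times, as y^32 =
  y. So x^2 + x^16 represents the functional given by x, and its zeros form the radical.\<close>

lemma pairing_eq: "pairing x y = Tr (y * (x\<^sup>2 + x ^ 16))"
proof -
  have "Tr (x * y\<^sup>2) = Tr ((x * y\<^sup>2) ^ (2 ^ 4))" by (rule Tr_frob[symmetric])
  also have "(x * y\<^sup>2) ^ (2 ^ 4) = x ^ 16 * y ^ 32" by (simp add: power_mult_distrib flip: power_mult)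
  also have "\<dots> = y * x ^ 16" by (simp only: power_32 mult.commute)
  finally have "Tr (x * y\<^sup>2) = Tr (y * x ^ 16)" .
  moreover have "x * y * (x + y) = y * x\<^sup>2 + x * y\<^sup>2" by (simp add: algebra_simps power2_eq_square)
  ultimately show ?thesis by (simp add: pairing_def Tr_add distrib_left)
qed

text \<open>x^2 + x^16 = x^2 (1 + x^14), and 14 is coprime to 31.\<close>

lemma pairing_radical: "x\<^sup>2 + x ^ 16 = 0 \<longleftrightarrow> x = 0 \<or> x = (1 :: 'a)"
proof
  assume *: "x\<^sup>2 + x ^ 16 = 0"
  have "x\<^sup>2 * x ^ 14 = x ^ 16" by (simp flip: power_add)
  also have "\<dots> = x\<^sup>2 * 1" using * by (simp add: add_eq_0_char2)
  finally have "x = 0 \<or> x ^ 14 = 1" unfolding mult_cancel_left by simp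
  then show "x = 0 \<or> x = 1" using power_coprime_31_eq_1[of x 14] coprime_31[of 14] by auto
qed (auto simp: add_self)

lemma pairing_add_right: "pairing x (y + z) = pairing x y + pairing x z"
  by (simp add: pairing_eq Tr_add distrib_right)

lemma pairing_commute: "pairing x y = pairing y x"
  by (simp add: pairing_def mult.commute add.commute)

lemma pairing_simps [simp]: "pairing x x = 0" "pairing 0 x = 0" "pairing x 0 = 0" "pairing 1 x = 0" "pairing x 1 = 0"
  using pairing_eq[of 1 x] pairing_commute[of x 1] by (simp_all add: pairing_def add_self)

lemma card_pairing_eq_0: "x \<notin> {0, 1} \<Longrightarrow> card {y. pairing x y = 0} = 16"
  unfolding pairing_eq by (rule card_Tr_mult_eq_0) (simp add: pairing_radical)

text \<open>Functionals with values in GF(2) are determined by their kernels, so x + y lies in the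
  radical.\<close>

lemma pairing_determines:
  assumes "\<And>z. pairing x z = 0 \<longleftrightarrow> pairing y z = 0"
  shows "x + y = 0 \<or> x + y = 1"
proof -
  have "pairing x z = pairing y z" for z
    using assms[of z] Tr_cases unfolding pairing_def by metis
  then have "Tr (z * ((x + y)\<^sup>2 + (x + y) ^ 16)) = 0" for z
    using pairing_add_right[of z x y] pairing_commute[of z]
    by (simp add: add_self flip: pairing_eq)
  then have "(x + y)\<^sup>2 + (x + y) ^ 16 = 0" by (rule Tr_mult_eq_0_imp)
  then show ?thesis by (simp add: pairing_radical)
qed

lemma isotropic_iff:
  "isotropic A \<longleftrightarrow> additive_subgroup A \<and> card A = 8 \<and> (\<forall>x\<in>A. \<forall>y\<in>A. pairing x y = 0)"
  by (simp add: isotropic_def pairing_def)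

text \<open>For a subgroup T, the GF(2)-span of T and v.\<close>

definition extend :: "'a \<Rightarrow> 'a set \<Rightarrow> 'a set" where
  "extend v T = T \<union> (+) v ` T"

lemma additive_subgroup_extend:
  assumes "additive_subgroup T"
  shows "additive_subgroup (extend v T)"
proof -
  have T: "0 \<in> T" "\<And>x y. x \<in> T \<Longrightarrow> y \<in> T \<Longrightarrow> x + y \<in> T"
    using assms by (auto simp: additive_subgroup_iff)
  have "x + y \<in> extend v T" if "x \<in> extend v T" "y \<in> extend v T" for x y
    using that T(2) by (auto simp: extend_def image_iff add.assoc add.left_commute[of _ v] char_2)
  then show ?thesis using T(1) by (auto simp: additive_subgroup_iff extend_def)
qed

lemma card_extend:
  assumes "additive_subgroup T" "v \<notin> T"
  shows "card (extend v T) = 2 * card T"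
proof -
  have T: "\<And>x y. x \<in> T \<Longrightarrow> y \<in> T \<Longrightarrow> x + y \<in> T"
    using assms by (auto simp: additive_subgroup_iff)
  have "v \<in> T" if "v + x \<in> T" "x \<in> T" for x
    using T[OF that] by (simp add: add.assoc add_self)
  then have "T \<inter> (+) v ` T = {}" using assms(2) by auto
  then show ?thesis unfolding extend_def by (subst card_Un_disjoint) (auto simp: card_image)
qed

lemma extend_subset: "additive_subgroup A \<Longrightarrow> T \<subseteq> A \<Longrightarrow> v \<in> A \<Longrightarrow> extend v T \<subseteq> A"
  by (auto simp: additive_subgroup_iff extend_def)

lemma pairing_extend:
  assumes "\<And>x y. x \<in> T \<Longrightarrow> y \<in> T \<Longrightarrow> pairing x y = 0" "\<And>x. x \<in> T \<Longrightarrow> pairing v x = 0"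
    "x \<in> extend v T" "y \<in> extend v T"
  shows "pairing x y = 0"
  using assms by (auto simp: extend_def pairing_add_right pairing_commute[of "v + _"] pairing_commute[of _ v])

lemma additive_subgroup_prime: "additive_subgroup {0, 1 :: 'a}"
  by (auto simp: additive_subgroup_iff add_self)

text \<open>Otherwise A together with 1 spans 16 elements, which is the full orthogonal space of
  each nonzero x in A. All these x would then define the same functional, so u + v would be 0 or 1
  for distinct nonzero u, v in A.\<close>

lemma one_mem_isotropic:
  assumes "isotropic A"
  shows "1 \<in> A"
proof (rule ccontr)
  assume one: "1 \<notin> A"
  have A: "additive_subgroup A" "card A = 8" "\<And>x y. x \<in> A \<Longrightarrow> y \<in> A \<Longrightarrow> pairing x y = 0"
    using assms by (auto simp: isotropic_iff)
  have perp: "{y. pairing x y = 0} = extend 1 A" if "x \<in> A - {0}" for x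
  proof (rule card_subset_eq[symmetric])
    show "extend 1 A \<subseteq> {y. pairing x y = 0}"
      using that A(3) by (auto simp: extend_def pairing_add_right)
    have "x \<notin> {0, 1}" using that one by auto
    then show "card (extend 1 A) = card {y. pairing x y = 0}"
      by (simp add: card_pairing_eq_0 card_extend[OF A(1) one] A(2))
  qed simp
  obtain u v w where uv: "u \<noteq> 0" "v \<notin> {0, u}" "A = {0, u, v, u + v, w, u + w, v + w, u + v + w}"
    using subgroup_basis[OF A(1,2)] by metis
  then have "{y. pairing u y = 0} = {y. pairing v y = 0}" by (simp add: perp)
  then have "u + v = 0 \<or> u + v = 1" by (intro pairing_determines) blast
  moreover have "u + v \<noteq> 0" using uv by (auto simp: add_eq_0_char2)
  moreover have "u + v \<in> A" using uv by simp
  ultimately show False using one by simp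
qed

text \<open>Double count of the pairs (u, v) that generate an isotropic subgroup together with 1.
  There are 30 choices of u and 16 - 4 = 12 of v, in all 360, and each subgroup arises from 6 * 4 =
  24 pairs.\<close>

lemma card_isotropic_subgroups: "card {A. isotropic A} = 15"
proof -
  define Flags where "Flags = (SIGMA u : UNIV - {0, 1}. {v. pairing u v = 0} - extend u {0, 1})"
  define Fib where "Fib A = (SIGMA u : A - {0, 1}. A - extend u {0, 1})" for A :: "'a set"
  have card_extend_u: "card (extend u {0, 1}) = 4" if "u \<notin> {0, 1}" for u
    using card_extend[OF additive_subgroup_prime that] by simp
  have "card ({v. pairing u v = 0} - extend u {0, 1}) = 12" if "u \<notin> {0, 1}" for u
  proof -
    have "extend u {0, 1} \<subseteq> {v. pairing u v = 0}" by (auto simp: extend_def pairing_add_right)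
    then show ?thesis by (simp add: card_Diff_subset card_extend_u[OF that] card_pairing_eq_0[OF that])
  qed
  then have "card Flags = 12 * card (UNIV - {0, 1 :: 'a})" by (simp add: Flags_def card_SigmaI)
  then have card_Flags: "card Flags = 360" by (simp add: card_Diff_subset card_field)
  have card_Fib: "card (Fib A) = 24" if A: "isotropic A" for A
  proof -
    have sub: "additive_subgroup A" "card A = 8" "{0, 1} \<subseteq> A"
      using A one_mem_isotropic[OF A] by (auto simp: isotropic_iff additive_subgroup_def)
    have "card (A - extend u {0, 1}) = 4" if u: "u \<in> A - {0, 1}" for u
    proof -
      have "extend u {0, 1} \<subseteq> A" using extend_subset[OF sub(1,3)] u by blast
      then show ?thesis using u by (simp add: card_Diff_subset card_extend_u sub(2))
    qed
    then have "card (Fib A) = 4 * card (A - {0, 1})" by (simp add: Fib_def card_SigmaI)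
    also have "card (A - {0, 1}) = 6" using sub by (simp add: card_Diff_subset)
    finally show ?thesis by simp
  qed
  have Fib_eq: "A = extend v (extend u {0, 1})" if A: "isotropic A" and uv: "(u, v) \<in> Fib A" for A u v
  proof (rule card_subset_eq[symmetric])
    have sub: "additive_subgroup A" "card A = 8" "{0, 1} \<subseteq> A"
      using A one_mem_isotropic[OF A] by (auto simp: isotropic_iff additive_subgroup_def)
    show "extend v (extend u {0, 1}) \<subseteq> A"
      using uv by (intro extend_subset sub) (auto simp: Fib_def)
    have "card (extend v (extend u {0, 1})) = 2 * card (extend u {0, 1})"
      using uv by (intro card_extend additive_subgroup_extend additive_subgroup_prime) (auto simp: Fib_def)
    then show "card (extend v (extend u {0, 1})) = card A"
      using uv by (simp add: card_extend_u Fib_def sub(2))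
  qed simp
  have "Flags = (\<Union>A\<in>{A. isotropic A}. Fib A)"
  proof (intro equalityI subsetI)
    fix p assume "p \<in> Flags"
    then obtain u v where p: "p = (u, v)" "u \<notin> {0, 1}" "pairing u v = 0" "v \<notin> extend u {0, 1}"
      by (auto simp: Flags_def)
    define A where "A = extend v (extend u {0, 1})"
    have "additive_subgroup A" unfolding A_def
      by (intro additive_subgroup_extend additive_subgroup_prime)
    moreover have "card A = 8"
      using card_extend[OF additive_subgroup_extend[OF additive_subgroup_prime] p(4)] p(2)
      by (simp add: A_def card_extend_u)
    moreover have "pairing x y = 0" if "x \<in> A" "y \<in> A" for x y
    proof (rule pairing_extend[OF _ _ that[unfolded A_def]])
      show "pairing x y = 0" if "x \<in> extend u {0, 1}" "y \<in> extend u {0, 1}" for x y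
        using that by (rule pairing_extend[rotated 2]) auto
      show "pairing v x = 0" if "x \<in> extend u {0, 1}" for x
        using that p(3) by (auto simp: extend_def pairing_add_right pairing_commute[of v u])
    qed
    ultimately have "isotropic A" by (simp add: isotropic_iff)
    moreover have "u \<in> A" "v \<in> A" by (auto simp: A_def extend_def)
    then have "p \<in> Fib A" using p by (auto simp: Fib_def)
    ultimately show "p \<in> (\<Union>A\<in>{A. isotropic A}. Fib A)" by blast
  next
    fix p assume "p \<in> (\<Union>A\<in>{A. isotropic A}. Fib A)"
    then show "p \<in> Flags" by (auto simp: Flags_def Fib_def isotropic_iff)
  qed
  also have "card \<dots> = (\<Sum>A\<in>{A. isotropic A}. card (Fib A))"
  proof (rule card_UN_disjoint)
    have "A = B" if "isotropic A" "isotropic B" "p \<in> Fib A" "p \<in> Fib B" for A B p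
      using that Fib_eq by (cases p) metis
    then show "\<forall>A\<in>{A. isotropic A}. \<forall>B\<in>{A. isotropic A}. A \<noteq> B \<longrightarrow> Fib A \<inter> Fib B = {}"
      by blast
  qed auto
  finally show ?thesis using card_Flags by (simp add: card_Fib)
qed

text \<open>Squaring would permute the six elements of A other than 0 and 1. One orbit has five
  elements, so the sixth would be fixed, but only 0 and 1 equal their squares.\<close>

lemma isotropic_not_square_closed:
  assumes A: "isotropic A" and sq: "\<And>x. x \<in> A \<Longrightarrow> x\<^sup>2 \<in> A"
  shows False
proof -
  have "{0, 1} \<subseteq> A" using A one_mem_isotropic[OF A] by (auto simp: isotropic_def additive_subgroup_def)
  then have card: "card (A - {0, 1}) = 6" using A by (simp add: card_Diff_subset isotropic_def)
  then have "A - {0, 1} \<noteq> {}" by (metis card.empty zero_neq_numeral)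
  then obtain x where x: "x \<in> A" "x \<noteq> 0" "x \<noteq> 1" by blast
  define X where "X = (\<lambda>k. x ^ k) ` {1, 2, 4, 8, 16}"
  have "inj_on (\<lambda>k. x ^ k) {1, 2, 4, 8, 16}"
    by (rule inj_on_subset[OF inj_on_power_31[OF x(2,3)]]) auto
  then have card_X: "card X = 5" unfolding X_def by (simp add: card_image)
  have pow: "x ^ (2 ^ i) \<in> A - {0, 1}" for i
  proof (induction i)
    case (Suc i)
    have "x ^ (2 ^ Suc i) = (x ^ (2 ^ i))\<^sup>2" by (simp add: mult.commute flip: power_mult)
    then show ?case using Suc sq by (auto simp: power2_eq_1_iff minus_eq)
  qed (use x in simp)
  have X: "X \<subseteq> A - {0, 1}"
    using pow[of 0] pow[of 1] pow[of 2] pow[of 3] pow[of 4] by (simp add: X_def)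
  have "card (A - {0, 1} - X) = 1" using X card card_X by (simp add: card_Diff_subset)
  then obtain y where y: "A - {0, 1} - X = {y}" by (meson card_1_singletonE)
  then have yA: "y \<in> A" "y \<notin> {0, 1}" "y \<notin> X" by auto
  have sq_X: "X \<subseteq> (\<lambda>z. z\<^sup>2) ` X"
  proof -
    have "(x ^ 16)\<^sup>2 = x ^ 32" by (simp flip: power_mult)
    then have "x ^ 1 = (x ^ 16)\<^sup>2" by (simp only: power_32 power_one_right)
    moreover have "x ^ 2 = (x ^ 1)\<^sup>2" "x ^ 4 = (x ^ 2)\<^sup>2" "x ^ 8 = (x ^ 4)\<^sup>2" "x ^ 16 = (x ^ 8)\<^sup>2"
      by (simp_all flip: power_mult)
    ultimately show ?thesis unfolding X_def by blast
  qed
  have "y\<^sup>2 \<notin> X" using sq_X yA(3) by (auto simp: square_inj)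
  moreover have "y\<^sup>2 \<in> A - {0, 1}" using sq yA by (auto simp: power2_eq_1_iff minus_eq)
  ultimately have "y\<^sup>2 = y" using y by blast
  then show False using yA(2) by (simp add: power2_eq_square)
qed

lemma inj_on_frob_isotropic:
  assumes A: "isotropic A"
  shows "inj_on (\<lambda>i. (\<lambda>x. x ^ (2 ^ i)) ` A) {..<5}"
proof -
  have False if ij: "i < j" "j < 5" "(\<lambda>x. x ^ (2 ^ i)) ` A = (\<lambda>x. x ^ (2 ^ j)) ` A" for i j :: nat
  proof -
    define n where "n = j - i"
    have inj: "inj (\<lambda>x :: 'a. x ^ (2 ^ i))"
      using field_automorphism_frob by (simp add: field_automorphism_def bij_is_inj)
    have "(\<lambda>x. x ^ (2 ^ j)) ` A = (\<lambda>x. x ^ (2 ^ i)) ` (\<lambda>x. x ^ (2 ^ n)) ` A"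
      using ij(1) by (simp add: image_image n_def mult.commute flip: power_mult power_add)
    then have A_eq: "A = (\<lambda>x. x ^ (2 ^ n)) ` A" using ij(3) by (simp add: inj_image_eq_iff[OF inj])
    have iter: "x ^ (2 ^ (n * k)) \<in> A" if "x \<in> A" for x k
    proof (induction k)
      case (Suc k)
      have "x ^ (2 ^ (n * Suc k)) = (x ^ (2 ^ (n * k))) ^ (2 ^ n)"
        by (simp add: power_add mult.commute flip: power_mult)
      then show ?case using Suc A_eq by blast
    qed (use that in simp)
    have "x\<^sup>2 \<in> A" if "x \<in> A" for x
    proof -
      have red: "z ^ (2 ^ (m + 5)) = z ^ (2 ^ m)" for z :: 'a and m :: nat
      proof -
        have "z ^ (2 ^ (m + 5)) = (z ^ (2 ^ m)) ^ 32" by (simp add: power_add flip: power_mult)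
        then show ?thesis by (simp only: power_32)
      qed
      have "n = 1 \<or> n = 2 \<or> n = 3 \<or> n = 4" using ij by (auto simp: n_def)
      \<comment> \<open>n is invertible modulo 5: the products 1 * 1, 2 * 3, 3 * 2, 4 * 4 are 1, 6,
        6, 16, and \<open>red\<close> lowers 6 and 16 to 1.\<close>
      then have "x ^ (2 ^ 1) \<in> A"
        using iter[OF that, of 1] iter[OF that, of 2] iter[OF that, of 3] iter[OF that, of 4]
          red[of x 1] red[of x 6] red[of x 11] by auto
      then show ?thesis by simp
    qed
    then show False using isotropic_not_square_closed[OF A] by blast
  qed
  then show ?thesis by (intro inj_onI) (metis lessThan_iff nat_neq_iff)
qed

lemma card_arc_iso_classes:
  "card ({K :: ('a ^ 3) set set. proper_mathon_arc K \<and> maximal_arc 8 K} // arc_iso) = 3"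
proof -
  define S where "S = {K :: ('a ^ 3) set set. proper_mathon_arc K \<and> maximal_arc 8 K}"
  define q where "q A = arc_iso `` {conic_arc (mathon_conics A)}" for A :: "'a set"
  have q_eq: "q A = q B \<longleftrightarrow> (conic_arc (mathon_conics A), conic_arc (mathon_conics B)) \<in> arc_iso" for A B
    unfolding q_def using eq_equiv_class_iff[OF equiv_arc_iso] by simp
  have "S // arc_iso = q ` {A. isotropic A}"
  proof (intro equalityI subsetI)
    fix c assume "c \<in> S // arc_iso"
    then obtain K where K: "K \<in> S" "c = arc_iso `` {K}" by (rule quotientE)
    then obtain A where A: "isotropic A" "(K, conic_arc (mathon_conics A)) \<in> arc_iso"
      using proper_mathon_arc_classification unfolding S_def by blast
    then have "c = q A" unfolding K(2) q_def by (intro equiv_class_eq[OF equiv_arc_iso])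
    then show "c \<in> q ` {A. isotropic A}" using A(1) by blast
  next
    fix c assume "c \<in> q ` {A. isotropic A}"
    then obtain A where A: "isotropic A" "c = q A" by blast
    then have "conic_arc (mathon_conics A) \<in> S"
      using maximal_arc_mathon_conics mathon_type_mathon_conics not_denniston_type_mathon_conics
      by (simp add: S_def proper_mathon_arc_def)
    then show "c \<in> S // arc_iso" unfolding A(2) q_def by (rule quotientI)
  qed
  \<comment> \<open>The fibres of \<open>q\<close> are the Frobenius orbits, all of full length
    5.\<close>
  moreover have "card {B \<in> {A. isotropic A}. q B = c} = 5" if c: "c \<in> q ` {A. isotropic A}" for c
  proof -
    obtain A where A: "isotropic A" "c = q A" using c by blast
    have "{B \<in> {A. isotropic A}. q B = c} = (\<lambda>i. (\<lambda>x. x ^ (2 ^ i)) ` A) ` {..<5}"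
    proof (intro equalityI subsetI)
      fix B assume "B \<in> {B \<in> {A. isotropic A}. q B = c}"
      then have "isotropic B" "q A = q B" using A(2) by auto
      then obtain \<sigma> where "field_automorphism \<sigma>" "B = \<sigma> ` A"
        unfolding q_eq using arc_iso_mathon_conics_iff[OF A(1)] by blast
      then show "B \<in> (\<lambda>i. (\<lambda>x. x ^ (2 ^ i)) ` A) ` {..<5}"
        using field_automorphism_eq_frob by blast
    next
      fix B assume "B \<in> (\<lambda>i. (\<lambda>x. x ^ (2 ^ i)) ` A) ` {..<5}"
      then obtain i :: nat where B: "B = (\<lambda>x. x ^ (2 ^ i)) ` A" by blast
      then have iso: "isotropic B" using isotropic_automorphism[OF field_automorphism_frob A(1)] by simp
      then have "q A = q B"
        unfolding q_eq arc_iso_mathon_conics_iff[OF A(1) iso] using B field_automorphism_frob by blast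
      then show "B \<in> {B \<in> {A. isotropic A}. q B = c}" using iso A(2) by simp
    qed
    then show ?thesis using inj_on_frob_isotropic[OF A(1)] by (simp add: card_image)
  qed
  then have "card {A :: 'a set. isotropic A} = 5 * card (q ` {A. isotropic A})"
    using sum.image_gen[of "{A :: 'a set. isotropic A}" "\<lambda>_. 1 :: nat" q] by simp
  ultimately show ?thesis by (simp add: card_isotropic_subgroups S_def)
qed

end

theorem mainTheorem3:
  assumes "CARD('a::{field,finite}) = 32"
  shows "card ({K :: ('a ^ 3) set set. proper_mathon_arc K \<and> maximal_arc 8 K} // arc_iso) = 3"
proof -
  interpret gf32 "TYPE('a)" by unfold_locales (rule assms)
  show ?thesis by (rule card_arc_iso_classes)
qed

end
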